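(* Let $K$ be a unital commutative ring and $\Lambda$ a set. Then the commutator-evaluation homomorphism $$\iota:\mathrm F^{\mathrm{Lie}}_K[X_\lambda:\lambda\in\Lambda]\to \mathrm F_K[X_\lambda:\lambda\in\Lambda]$$ is injective; i.e. the free Lie $K$-algebra embeds into the noncommutative polynomial algebra by commutator-evaluation.
   Context: A Lie $K$-algebra is a $K$-module with a $K$-bilinear bracket satisfying $[x,x]=0$ and the Jacobi identity. $\mathrm F^{\mathrm{Lie}}_K[X_\lambda:\lambda\in\Lambda]$ is the free Lie $K$-algebra on the generators $X_\lambda$. $\mathrm F_K[X_\lambda:\lambda\in\Lambda]$ is the free unital associative (noncommutative polynomial) $K$-algebra on the $X_\lambda$, regarded as a Lie $K$-algebra under the commutator $[a,b]=ab-ba$. The commutator-evaluation $\iota$ is the unique Lie $K$-algebra homomorphism with $\iota(X_\lambda)=X_\lambda$ for all $\lambda\in\Lambda$. *)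

theory Defs
  imports "HOL-Algebra.Module"
begin

section \<open>Lie algebras\<close>

text \<open>
  The coefficient ring is an arbitrary \<^locale>\<open>cring\<close>; the zero ring is allowed.
  A Lie algebra reuses the module record: its bracket is the \<^const>\<open>mult\<close> field, which
  \<^locale>\<open>module\<close> does not constrain. The \<^const>\<open>one\<close> field has no meaning for Lie algebras.
\<close>

locale lie_algebra = module +
  assumes bracket_closed:
      "\<lbrakk>x \<in> carrier M; y \<in> carrier M\<rbrakk> \<Longrightarrow> x \<otimes>\<^bsub>M\<^esub> y \<in> carrier M"
    and bracket_add_left:
      "\<lbrakk>x \<in> carrier M; y \<in> carrier M; z \<in> carrier M\<rbrakk> \<Longrightarrow>
        (x \<oplus>\<^bsub>M\<^esub> y) \<otimes>\<^bsub>M\<^esub> z = x \<otimes>\<^bsub>M\<^esub> z \<oplus>\<^bsub>M\<^esub> y \<otimes>\<^bsub>M\<^esub> z"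
    and bracket_add_right:
      "\<lbrakk>x \<in> carrier M; y \<in> carrier M; z \<in> carrier M\<rbrakk> \<Longrightarrow>
        x \<otimes>\<^bsub>M\<^esub> (y \<oplus>\<^bsub>M\<^esub> z) = x \<otimes>\<^bsub>M\<^esub> y \<oplus>\<^bsub>M\<^esub> x \<otimes>\<^bsub>M\<^esub> z"
    and bracket_smult_left:
      "\<lbrakk>a \<in> carrier R; x \<in> carrier M; y \<in> carrier M\<rbrakk> \<Longrightarrow>
        (a \<odot>\<^bsub>M\<^esub> x) \<otimes>\<^bsub>M\<^esub> y = a \<odot>\<^bsub>M\<^esub> (x \<otimes>\<^bsub>M\<^esub> y)"
    and bracket_smult_right:
      "\<lbrakk>a \<in> carrier R; x \<in> carrier M; y \<in> carrier M\<rbrakk> \<Longrightarrow>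
        x \<otimes>\<^bsub>M\<^esub> (a \<odot>\<^bsub>M\<^esub> y) = a \<odot>\<^bsub>M\<^esub> (x \<otimes>\<^bsub>M\<^esub> y)"
    and bracket_self:
      "x \<in> carrier M \<Longrightarrow> x \<otimes>\<^bsub>M\<^esub> x = \<zero>\<^bsub>M\<^esub>"
    and jacobi:
      "\<lbrakk>x \<in> carrier M; y \<in> carrier M; z \<in> carrier M\<rbrakk> \<Longrightarrow>
        x \<otimes>\<^bsub>M\<^esub> (y \<otimes>\<^bsub>M\<^esub> z) \<oplus>\<^bsub>M\<^esub> (y \<otimes>\<^bsub>M\<^esub> (z \<otimes>\<^bsub>M\<^esub> x) \<oplus>\<^bsub>M\<^esub> z \<otimes>\<^bsub>M\<^esub> (x \<otimes>\<^bsub>M\<^esub> y)) = \<zero>\<^bsub>M\<^esub>"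

definition lie_hom ::
  "('k, 'r) ring_scheme \<Rightarrow> ('k, 'a, 'm) module_scheme \<Rightarrow> ('k, 'b, 'n) module_scheme \<Rightarrow> ('a \<Rightarrow> 'b) set"
where
  "lie_hom K L M = {f \<in> carrier L \<rightarrow> carrier M.
     (\<forall>x\<in>carrier L. \<forall>y\<in>carrier L. f (x \<oplus>\<^bsub>L\<^esub> y) = f x \<oplus>\<^bsub>M\<^esub> f y) \<and>
     (\<forall>a\<in>carrier K. \<forall>x\<in>carrier L. f (a \<odot>\<^bsub>L\<^esub> x) = a \<odot>\<^bsub>M\<^esub> f x) \<and>
     (\<forall>x\<in>carrier L. \<forall>y\<in>carrier L. f (x \<otimes>\<^bsub>L\<^esub> y) = f x \<otimes>\<^bsub>M\<^esub> f y)}"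

text \<open>The locale \<^locale>\<open>algebra\<close> of the library is commutative, hence a separate locale.\<close>

locale assoc_algebra = module + M?: ring M +
  assumes smult_mult_left:
      "\<lbrakk>a \<in> carrier R; x \<in> carrier M; y \<in> carrier M\<rbrakk> \<Longrightarrow>
        (a \<odot>\<^bsub>M\<^esub> x) \<otimes>\<^bsub>M\<^esub> y = a \<odot>\<^bsub>M\<^esub> (x \<otimes>\<^bsub>M\<^esub> y)"
    and smult_mult_right:
      "\<lbrakk>a \<in> carrier R; x \<in> carrier M; y \<in> carrier M\<rbrakk> \<Longrightarrow>
        x \<otimes>\<^bsub>M\<^esub> (a \<odot>\<^bsub>M\<^esub> y) = a \<odot>\<^bsub>M\<^esub> (x \<otimes>\<^bsub>M\<^esub> y)"

definition commutator_lie :: "('k, 'a, 'm) module_scheme \<Rightarrow> ('k, 'a, 'm) module_scheme" where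
  "commutator_lie A = A\<lparr>mult := \<lambda>a b. a \<otimes>\<^bsub>A\<^esub> b \<ominus>\<^bsub>A\<^esub> b \<otimes>\<^bsub>A\<^esub> a\<rparr>"

lemma commutator_lie_simps [simp]:
  "carrier (commutator_lie A) = carrier A"
  "add (commutator_lie A) = add A"
  "zero (commutator_lie A) = zero A"
  "smult (commutator_lie A) = smult A"
  "mult (commutator_lie A) = (\<lambda>a b. a \<otimes>\<^bsub>A\<^esub> b \<ominus>\<^bsub>A\<^esub> b \<otimes>\<^bsub>A\<^esub> a)"
  by (simp_all add: commutator_lie_def)

lemma (in assoc_algebra) commutator_lie_algebra: "lie_algebra R (commutator_lie M)"
proof -
  have ab: "abelian_group (commutator_lie M)"
    by (rule abelian_groupI) (auto simp: M.add.m_ac intro: M.l_neg)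
  have md: "module R (commutator_lie M)"
    by (rule moduleI) (simp_all add: ab R.is_cring smult_l_distr smult_r_distr smult_assoc1)
  have jac: "x \<otimes>\<^bsub>M\<^esub> (y \<otimes>\<^bsub>M\<^esub> z \<ominus>\<^bsub>M\<^esub> z \<otimes>\<^bsub>M\<^esub> y) \<ominus>\<^bsub>M\<^esub> (y \<otimes>\<^bsub>M\<^esub> z \<ominus>\<^bsub>M\<^esub> z \<otimes>\<^bsub>M\<^esub> y) \<otimes>\<^bsub>M\<^esub> x \<oplus>\<^bsub>M\<^esub>
      (y \<otimes>\<^bsub>M\<^esub> (z \<otimes>\<^bsub>M\<^esub> x \<ominus>\<^bsub>M\<^esub> x \<otimes>\<^bsub>M\<^esub> z) \<ominus>\<^bsub>M\<^esub> (z \<otimes>\<^bsub>M\<^esub> x \<ominus>\<^bsub>M\<^esub> x \<otimes>\<^bsub>M\<^esub> z) \<otimes>\<^bsub>M\<^esub> y \<oplus>\<^bsub>M\<^esub>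
      (z \<otimes>\<^bsub>M\<^esub> (x \<otimes>\<^bsub>M\<^esub> y \<ominus>\<^bsub>M\<^esub> y \<otimes>\<^bsub>M\<^esub> x) \<ominus>\<^bsub>M\<^esub> (x \<otimes>\<^bsub>M\<^esub> y \<ominus>\<^bsub>M\<^esub> y \<otimes>\<^bsub>M\<^esub> x) \<otimes>\<^bsub>M\<^esub> z)) = \<zero>\<^bsub>M\<^esub>"
    if "x \<in> carrier M" "y \<in> carrier M" "z \<in> carrier M" for x y z
  proof -
    define S where "S = (\<lambda>u v w. u \<otimes>\<^bsub>M\<^esub> (v \<otimes>\<^bsub>M\<^esub> w) \<oplus>\<^bsub>M\<^esub> w \<otimes>\<^bsub>M\<^esub> (v \<otimes>\<^bsub>M\<^esub> u))"
    have S: "S u v w \<in> carrier M" and S_sym: "S u v w = S w v u"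
      and nested: "u \<otimes>\<^bsub>M\<^esub> (v \<otimes>\<^bsub>M\<^esub> w \<ominus>\<^bsub>M\<^esub> w \<otimes>\<^bsub>M\<^esub> v) \<ominus>\<^bsub>M\<^esub> (v \<otimes>\<^bsub>M\<^esub> w \<ominus>\<^bsub>M\<^esub> w \<otimes>\<^bsub>M\<^esub> v) \<otimes>\<^bsub>M\<^esub> u =
        S u v w \<ominus>\<^bsub>M\<^esub> S u w v"
      if "u \<in> carrier M" "v \<in> carrier M" "w \<in> carrier M" for u v w
      using that unfolding S_def
      by (simp_all add: a_minus_def M.l_distr M.r_distr M.l_minus M.r_minus M.minus_add
          M.m_assoc M.add.m_ac)
    have tele: "a \<ominus>\<^bsub>M\<^esub> b \<oplus>\<^bsub>M\<^esub> (b \<ominus>\<^bsub>M\<^esub> c \<oplus>\<^bsub>M\<^esub> (c \<ominus>\<^bsub>M\<^esub> a)) = \<zero>\<^bsub>M\<^esub>"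
      if "a \<in> carrier M" "b \<in> carrier M" "c \<in> carrier M" for a b c
      using that by (simp add: a_minus_def M.a_assoc M.r_neg M.r_neg1)
    show ?thesis
      using that tele[OF S[of x y z] S[of x z y] S[of y x z]]
      by (simp add: nested S_sym[of y z x] S_sym[of z x y] S_sym[of z y x])
  qed
  show ?thesis
  proof (intro lie_algebra.intro md lie_algebra_axioms.intro, simp_all only: commutator_lie_simps)
    fix x y z assume x: "x \<in> carrier M" and y: "y \<in> carrier M" and z: "z \<in> carrier M"
    show "(x \<oplus>\<^bsub>M\<^esub> y) \<otimes>\<^bsub>M\<^esub> z \<ominus>\<^bsub>M\<^esub> z \<otimes>\<^bsub>M\<^esub> (x \<oplus>\<^bsub>M\<^esub> y) =
        x \<otimes>\<^bsub>M\<^esub> z \<ominus>\<^bsub>M\<^esub> z \<otimes>\<^bsub>M\<^esub> x \<oplus>\<^bsub>M\<^esub> (y \<otimes>\<^bsub>M\<^esub> z \<ominus>\<^bsub>M\<^esub> z \<otimes>\<^bsub>M\<^esub> y)"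
      using x y z by algebra
    show "x \<otimes>\<^bsub>M\<^esub> (y \<oplus>\<^bsub>M\<^esub> z) \<ominus>\<^bsub>M\<^esub> (y \<oplus>\<^bsub>M\<^esub> z) \<otimes>\<^bsub>M\<^esub> x =
        x \<otimes>\<^bsub>M\<^esub> y \<ominus>\<^bsub>M\<^esub> y \<otimes>\<^bsub>M\<^esub> x \<oplus>\<^bsub>M\<^esub> (x \<otimes>\<^bsub>M\<^esub> z \<ominus>\<^bsub>M\<^esub> z \<otimes>\<^bsub>M\<^esub> x)"
      using x y z by algebra
  next
    fix a x y assume "a \<in> carrier R" "x \<in> carrier M" "y \<in> carrier M"
    then show "(a \<odot>\<^bsub>M\<^esub> x) \<otimes>\<^bsub>M\<^esub> y \<ominus>\<^bsub>M\<^esub> y \<otimes>\<^bsub>M\<^esub> (a \<odot>\<^bsub>M\<^esub> x) = a \<odot>\<^bsub>M\<^esub> (x \<otimes>\<^bsub>M\<^esub> y \<ominus>\<^bsub>M\<^esub> y \<otimes>\<^bsub>M\<^esub> x)"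
      and "x \<otimes>\<^bsub>M\<^esub> (a \<odot>\<^bsub>M\<^esub> y) \<ominus>\<^bsub>M\<^esub> (a \<odot>\<^bsub>M\<^esub> y) \<otimes>\<^bsub>M\<^esub> x = a \<odot>\<^bsub>M\<^esub> (x \<otimes>\<^bsub>M\<^esub> y \<ominus>\<^bsub>M\<^esub> y \<otimes>\<^bsub>M\<^esub> x)"
      by (simp_all add: a_minus_def smult_mult_left smult_mult_right smult_r_distr smult_r_minus)
  qed (use jac in \<open>simp_all add: M.r_neg a_minus_def\<close>)
qed


section \<open>The free Lie algebra\<close>

text \<open>
  The free Lie \<open>K\<close>-algebra on generators indexed by \<open>\<Lambda>\<close> is the set of formal expressions in the
  generators modulo the least congruence that contains the module axioms, bilinearity of the
  bracket, \<open>[x, x] = 0\<close> and the Jacobi identity. Its universal property is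
  \<open>free_lie_universal\<close> below.
\<close>

datatype ('k, 'x) lie_expr =
    Gen 'x
  | Zero
  | Add "('k, 'x) lie_expr" "('k, 'x) lie_expr"
  | Neg "('k, 'x) lie_expr"
  | Scale 'k "('k, 'x) lie_expr"
  | Bracket "('k, 'x) lie_expr" "('k, 'x) lie_expr"

inductive_set lie_exprs :: "('k, 'r) ring_scheme \<Rightarrow> 'x set \<Rightarrow> ('k, 'x) lie_expr set"
  for K :: "('k, 'r) ring_scheme" and \<Lambda> :: "'x set"
where
  Gen: "x \<in> \<Lambda> \<Longrightarrow> Gen x \<in> lie_exprs K \<Lambda>"
| Zero: "Zero \<in> lie_exprs K \<Lambda>"
| Add: "\<lbrakk>s \<in> lie_exprs K \<Lambda>; t \<in> lie_exprs K \<Lambda>\<rbrakk> \<Longrightarrow> Add s t \<in> lie_exprs K \<Lambda>"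
| Neg: "t \<in> lie_exprs K \<Lambda> \<Longrightarrow> Neg t \<in> lie_exprs K \<Lambda>"
| Scale: "\<lbrakk>a \<in> carrier K; t \<in> lie_exprs K \<Lambda>\<rbrakk> \<Longrightarrow> Scale a t \<in> lie_exprs K \<Lambda>"
| Bracket: "\<lbrakk>s \<in> lie_exprs K \<Lambda>; t \<in> lie_exprs K \<Lambda>\<rbrakk> \<Longrightarrow> Bracket s t \<in> lie_exprs K \<Lambda>"

inductive lie_cong ::
  "('k, 'r) ring_scheme \<Rightarrow> 'x set \<Rightarrow> ('k, 'x) lie_expr \<Rightarrow> ('k, 'x) lie_expr \<Rightarrow> bool"
  for K :: "('k, 'r) ring_scheme" and \<Lambda> :: "'x set"
where
  refl: "t \<in> lie_exprs K \<Lambda> \<Longrightarrow> lie_cong K \<Lambda> t t"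
| sym: "lie_cong K \<Lambda> s t \<Longrightarrow> lie_cong K \<Lambda> t s"
| trans: "\<lbrakk>lie_cong K \<Lambda> s t; lie_cong K \<Lambda> t u\<rbrakk> \<Longrightarrow> lie_cong K \<Lambda> s u"
| cong_Add: "\<lbrakk>lie_cong K \<Lambda> s s'; lie_cong K \<Lambda> t t'\<rbrakk> \<Longrightarrow> lie_cong K \<Lambda> (Add s t) (Add s' t')"
| cong_Neg: "lie_cong K \<Lambda> t t' \<Longrightarrow> lie_cong K \<Lambda> (Neg t) (Neg t')"
| cong_Scale: "\<lbrakk>a \<in> carrier K; lie_cong K \<Lambda> t t'\<rbrakk> \<Longrightarrow> lie_cong K \<Lambda> (Scale a t) (Scale a t')"
| cong_Bracket:
    "\<lbrakk>lie_cong K \<Lambda> s s'; lie_cong K \<Lambda> t t'\<rbrakk> \<Longrightarrow> lie_cong K \<Lambda> (Bracket s t) (Bracket s' t')"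
| add_assoc: "\<lbrakk>s \<in> lie_exprs K \<Lambda>; t \<in> lie_exprs K \<Lambda>; u \<in> lie_exprs K \<Lambda>\<rbrakk> \<Longrightarrow>
    lie_cong K \<Lambda> (Add (Add s t) u) (Add s (Add t u))"
| add_comm: "\<lbrakk>s \<in> lie_exprs K \<Lambda>; t \<in> lie_exprs K \<Lambda>\<rbrakk> \<Longrightarrow>
    lie_cong K \<Lambda> (Add s t) (Add t s)"
| add_zero: "t \<in> lie_exprs K \<Lambda> \<Longrightarrow> lie_cong K \<Lambda> (Add Zero t) t"
| add_neg: "t \<in> lie_exprs K \<Lambda> \<Longrightarrow> lie_cong K \<Lambda> (Add (Neg t) t) Zero"
| scale_add_left: "\<lbrakk>a \<in> carrier K; b \<in> carrier K; t \<in> lie_exprs K \<Lambda>\<rbrakk> \<Longrightarrow>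
    lie_cong K \<Lambda> (Scale (a \<oplus>\<^bsub>K\<^esub> b) t) (Add (Scale a t) (Scale b t))"
| scale_add_right: "\<lbrakk>a \<in> carrier K; s \<in> lie_exprs K \<Lambda>; t \<in> lie_exprs K \<Lambda>\<rbrakk> \<Longrightarrow>
    lie_cong K \<Lambda> (Scale a (Add s t)) (Add (Scale a s) (Scale a t))"
| scale_scale: "\<lbrakk>a \<in> carrier K; b \<in> carrier K; t \<in> lie_exprs K \<Lambda>\<rbrakk> \<Longrightarrow>
    lie_cong K \<Lambda> (Scale (a \<otimes>\<^bsub>K\<^esub> b) t) (Scale a (Scale b t))"
| scale_one: "t \<in> lie_exprs K \<Lambda> \<Longrightarrow> lie_cong K \<Lambda> (Scale \<one>\<^bsub>K\<^esub> t) t"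
| bracket_add_left: "\<lbrakk>s \<in> lie_exprs K \<Lambda>; t \<in> lie_exprs K \<Lambda>; u \<in> lie_exprs K \<Lambda>\<rbrakk> \<Longrightarrow>
    lie_cong K \<Lambda> (Bracket (Add s t) u) (Add (Bracket s u) (Bracket t u))"
| bracket_add_right: "\<lbrakk>s \<in> lie_exprs K \<Lambda>; t \<in> lie_exprs K \<Lambda>; u \<in> lie_exprs K \<Lambda>\<rbrakk> \<Longrightarrow>
    lie_cong K \<Lambda> (Bracket s (Add t u)) (Add (Bracket s t) (Bracket s u))"
| bracket_scale_left: "\<lbrakk>a \<in> carrier K; s \<in> lie_exprs K \<Lambda>; t \<in> lie_exprs K \<Lambda>\<rbrakk> \<Longrightarrow>
    lie_cong K \<Lambda> (Bracket (Scale a s) t) (Scale a (Bracket s t))"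
| bracket_scale_right: "\<lbrakk>a \<in> carrier K; s \<in> lie_exprs K \<Lambda>; t \<in> lie_exprs K \<Lambda>\<rbrakk> \<Longrightarrow>
    lie_cong K \<Lambda> (Bracket s (Scale a t)) (Scale a (Bracket s t))"
| bracket_self: "t \<in> lie_exprs K \<Lambda> \<Longrightarrow> lie_cong K \<Lambda> (Bracket t t) Zero"
| jacobi: "\<lbrakk>s \<in> lie_exprs K \<Lambda>; t \<in> lie_exprs K \<Lambda>; u \<in> lie_exprs K \<Lambda>\<rbrakk> \<Longrightarrow>
    lie_cong K \<Lambda>
      (Add (Bracket s (Bracket t u)) (Add (Bracket t (Bracket u s)) (Bracket u (Bracket s t)))) Zero"

definition lie_rel ::
  "('k, 'r) ring_scheme \<Rightarrow> 'x set \<Rightarrow> (('k, 'x) lie_expr \<times> ('k, 'x) lie_expr) set"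
where
  "lie_rel K \<Lambda> = {(s, t). lie_cong K \<Lambda> s t}"

definition lie_class ::
  "('k, 'r) ring_scheme \<Rightarrow> 'x set \<Rightarrow> ('k, 'x) lie_expr \<Rightarrow> ('k, 'x) lie_expr set"
where
  "lie_class K \<Lambda> t = lie_rel K \<Lambda> `` {t}"

text \<open>The \<^const>\<open>one\<close> field below is a dummy.\<close>

definition free_lie ::
  "('k, 'r) ring_scheme \<Rightarrow> 'x set \<Rightarrow> ('k, ('k, 'x) lie_expr set) module"
where
  "free_lie K \<Lambda> = \<lparr>
     carrier = lie_exprs K \<Lambda> // lie_rel K \<Lambda>,
     mult = (\<lambda>A B. \<Union>s\<in>A. \<Union>t\<in>B. lie_class K \<Lambda> (Bracket s t)),
     one = undefined,
     zero = lie_class K \<Lambda> Zero,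
     add = (\<lambda>A B. \<Union>s\<in>A. \<Union>t\<in>B. lie_class K \<Lambda> (Add s t)),
     smult = (\<lambda>a A. \<Union>t\<in>A. lie_class K \<Lambda> (Scale a t))\<rparr>"

definition free_lie_gen ::
  "('k, 'r) ring_scheme \<Rightarrow> 'x set \<Rightarrow> 'x \<Rightarrow> ('k, 'x) lie_expr set"
where
  "free_lie_gen K \<Lambda> x = lie_class K \<Lambda> (Gen x)"

lemma lie_cong_exprs:
  assumes "cring K" "lie_cong K \<Lambda> s t"
  shows "s \<in> lie_exprs K \<Lambda> \<and> t \<in> lie_exprs K \<Lambda>"
proof -
  interpret cring K by fact
  show ?thesis
    using assms(2) by induction (auto intro: lie_exprs.intros)
qed

lemma equiv_lie_rel:
  assumes "cring K"
  shows "equiv (lie_exprs K \<Lambda>) (lie_rel K \<Lambda>)"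
proof (rule equivI)
  show "lie_rel K \<Lambda> \<subseteq> lie_exprs K \<Lambda> \<times> lie_exprs K \<Lambda>"
    using lie_cong_exprs[OF assms] by (auto simp: lie_rel_def)
  show "refl_on (lie_exprs K \<Lambda>) (lie_rel K \<Lambda>)"
    using lie_cong_exprs[OF assms] by (auto simp: lie_rel_def refl_on_def intro: lie_cong.refl)
  show "sym (lie_rel K \<Lambda>)"
    by (auto simp: lie_rel_def sym_def intro: lie_cong.sym)
  show "trans (lie_rel K \<Lambda>)"
    by (auto simp: lie_rel_def trans_def intro: lie_cong.trans)
qed

lemma lie_class_eq_iff:
  assumes "cring K" "s \<in> lie_exprs K \<Lambda>" "t \<in> lie_exprs K \<Lambda>"
  shows "lie_class K \<Lambda> s = lie_class K \<Lambda> t \<longleftrightarrow> lie_cong K \<Lambda> s t"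
  using eq_equiv_class_iff[OF equiv_lie_rel[OF assms(1)] assms(2,3)]
  by (simp add: lie_class_def lie_rel_def)

lemma lie_class_eqI:
  assumes "cring K" "lie_cong K \<Lambda> s t"
  shows "lie_class K \<Lambda> s = lie_class K \<Lambda> t"
  using assms lie_class_eq_iff lie_cong_exprs by blast

lemma mem_lie_class:
  "u \<in> lie_class K \<Lambda> t \<longleftrightarrow> lie_cong K \<Lambda> t u"
  by (simp add: lie_class_def lie_rel_def)

lemma free_lie_carrier:
  "carrier (free_lie K \<Lambda>) = lie_class K \<Lambda> ` lie_exprs K \<Lambda>"
  by (auto simp: free_lie_def quotient_def lie_class_def)

lemma free_lie_zero: "\<zero>\<^bsub>free_lie K \<Lambda>\<^esub> = lie_class K \<Lambda> Zero"
  by (simp add: free_lie_def)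

lemma free_lie_ops:
  assumes "cring K" "s \<in> lie_exprs K \<Lambda>" "t \<in> lie_exprs K \<Lambda>"
  shows free_lie_add:
      "lie_class K \<Lambda> s \<oplus>\<^bsub>free_lie K \<Lambda>\<^esub> lie_class K \<Lambda> t = lie_class K \<Lambda> (Add s t)"
    and free_lie_bracket:
      "lie_class K \<Lambda> s \<otimes>\<^bsub>free_lie K \<Lambda>\<^esub> lie_class K \<Lambda> t = lie_class K \<Lambda> (Bracket s t)"
proof -
  have *: "(\<Union>s'\<in>lie_class K \<Lambda> s. \<Union>t'\<in>lie_class K \<Lambda> t. lie_class K \<Lambda> (F s' t')) = lie_class K \<Lambda> (F s t)"
    if "\<And>s' t'. \<lbrakk>lie_cong K \<Lambda> s s'; lie_cong K \<Lambda> t t'\<rbrakk> \<Longrightarrow> lie_cong K \<Lambda> (F s t) (F s' t')" for F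
  proof -
    have "lie_class K \<Lambda> (F s' t') = lie_class K \<Lambda> (F s t)"
      if "s' \<in> lie_class K \<Lambda> s" "t' \<in> lie_class K \<Lambda> t" for s' t'
      using that lie_class_eqI[OF assms(1)] \<open>\<And>s' t'. _ \<Longrightarrow> _ \<Longrightarrow> lie_cong K \<Lambda> (F s t) (F s' t')\<close>
      by (metis mem_lie_class)
    moreover have "s \<in> lie_class K \<Lambda> s" "t \<in> lie_class K \<Lambda> t"
      using assms by (auto simp: mem_lie_class intro: lie_cong.refl)
    ultimately show ?thesis by blast
  qed
  show "lie_class K \<Lambda> s \<oplus>\<^bsub>free_lie K \<Lambda>\<^esub> lie_class K \<Lambda> t = lie_class K \<Lambda> (Add s t)"
    using *[of Add] by (simp add: free_lie_def lie_cong.cong_Add)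
  show "lie_class K \<Lambda> s \<otimes>\<^bsub>free_lie K \<Lambda>\<^esub> lie_class K \<Lambda> t = lie_class K \<Lambda> (Bracket s t)"
    using *[of Bracket] by (simp add: free_lie_def lie_cong.cong_Bracket)
qed

lemma free_lie_smult:
  assumes "cring K" "a \<in> carrier K" "t \<in> lie_exprs K \<Lambda>"
  shows "a \<odot>\<^bsub>free_lie K \<Lambda>\<^esub> lie_class K \<Lambda> t = lie_class K \<Lambda> (Scale a t)"
proof -
  have "(\<Union>t'\<in>lie_class K \<Lambda> t. lie_class K \<Lambda> (Scale a t')) =
      (\<Union>t'\<in>lie_class K \<Lambda> t. lie_class K \<Lambda> (Scale a t))"
  proof (rule SUP_cong[OF HOL.refl])
    fix t' assume "t' \<in> lie_class K \<Lambda> t"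
    then have "lie_cong K \<Lambda> t t'" by (simp only: mem_lie_class)
    from lie_class_eqI[OF assms(1) lie_cong.sym[OF lie_cong.cong_Scale[OF assms(2) this]]]
    show "lie_class K \<Lambda> (Scale a t') = lie_class K \<Lambda> (Scale a t)" .
  qed
  moreover have "t \<in> lie_class K \<Lambda> t"
    using assms by (auto simp: mem_lie_class intro: lie_cong.refl)
  ultimately show ?thesis
    by (auto simp: free_lie_def)
qed

lemma lie_algebra_free_lie:
  assumes K: "cring K"
  shows "lie_algebra K (free_lie K \<Lambda>)"
proof -
  interpret cring K by fact
  note ops = free_lie_zero free_lie_add[OF K] free_lie_bracket[OF K] free_lie_smult[OF K]
    lie_exprs.intros
  note ax = lie_class_eqI[OF K]
  have ab: "abelian_group (free_lie K \<Lambda>)"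
  proof (rule abelian_groupI; unfold free_lie_carrier; clarify?)
    fix s t u assume st: "s \<in> lie_exprs K \<Lambda>" "t \<in> lie_exprs K \<Lambda>" and u: "u \<in> lie_exprs K \<Lambda>"
    show "lie_class K \<Lambda> s \<oplus>\<^bsub>free_lie K \<Lambda>\<^esub> lie_class K \<Lambda> t \<oplus>\<^bsub>free_lie K \<Lambda>\<^esub> lie_class K \<Lambda> u =
        lie_class K \<Lambda> s \<oplus>\<^bsub>free_lie K \<Lambda>\<^esub> (lie_class K \<Lambda> t \<oplus>\<^bsub>free_lie K \<Lambda>\<^esub> lie_class K \<Lambda> u)"
      using ax[OF lie_cong.add_assoc[OF st u]] st u by (simp add: ops)
  next
    fix s t assume st: "s \<in> lie_exprs K \<Lambda>" "t \<in> lie_exprs K \<Lambda>"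
    show "lie_class K \<Lambda> s \<oplus>\<^bsub>free_lie K \<Lambda>\<^esub> lie_class K \<Lambda> t =
        lie_class K \<Lambda> t \<oplus>\<^bsub>free_lie K \<Lambda>\<^esub> lie_class K \<Lambda> s"
      using st by (simp only: ops ax[OF lie_cong.add_comm])
  next
    fix t assume t: "t \<in> lie_exprs K \<Lambda>"
    show "\<exists>A\<in>lie_class K \<Lambda> ` lie_exprs K \<Lambda>.
        A \<oplus>\<^bsub>free_lie K \<Lambda>\<^esub> lie_class K \<Lambda> t = \<zero>\<^bsub>free_lie K \<Lambda>\<^esub>"
      using ax[OF lie_cong.add_neg[OF t]] t by (intro bexI[of _ "lie_class K \<Lambda> (Neg t)"]) (simp_all add: ops)
  qed (simp_all add: ops ax[OF lie_cong.add_zero])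
  have md: "module K (free_lie K \<Lambda>)"
    by (rule moduleI; (rule K ab)?; unfold free_lie_carrier; clarify?)
      (simp_all add: ops ax[OF lie_cong.scale_add_left] ax[OF lie_cong.scale_add_right]
        ax[OF lie_cong.scale_scale] ax[OF lie_cong.scale_one])
  show ?thesis
    by (rule lie_algebra.intro[OF md]; unfold_locales; unfold free_lie_carrier; clarify?)
      (simp_all add: ops ax[OF lie_cong.bracket_add_left] ax[OF lie_cong.bracket_add_right]
        ax[OF lie_cong.bracket_scale_left] ax[OF lie_cong.bracket_scale_right]
        ax[OF lie_cong.bracket_self] ax[OF lie_cong.jacobi])
qed

lemma free_lie_gen_closed:
  "x \<in> \<Lambda> \<Longrightarrow> free_lie_gen K \<Lambda> x \<in> carrier (free_lie K \<Lambda>)"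
  by (simp add: free_lie_gen_def free_lie_carrier lie_exprs.Gen)

primrec lie_eval :: "('k, 'a, 'm) module_scheme \<Rightarrow> ('x \<Rightarrow> 'a) \<Rightarrow> ('k, 'x) lie_expr \<Rightarrow> 'a" where
  "lie_eval M g (Gen x) = g x"
| "lie_eval M g Zero = \<zero>\<^bsub>M\<^esub>"
| "lie_eval M g (Add s t) = lie_eval M g s \<oplus>\<^bsub>M\<^esub> lie_eval M g t"
| "lie_eval M g (Neg t) = \<ominus>\<^bsub>M\<^esub> lie_eval M g t"
| "lie_eval M g (Scale a t) = a \<odot>\<^bsub>M\<^esub> lie_eval M g t"
| "lie_eval M g (Bracket s t) = lie_eval M g s \<otimes>\<^bsub>M\<^esub> lie_eval M g t"

lemma (in lie_algebra) lie_eval_closed: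
  assumes "g \<in> \<Lambda> \<rightarrow> carrier M" "t \<in> lie_exprs R \<Lambda>"
  shows "lie_eval M g t \<in> carrier M"
  using assms(2) by induction (use assms(1) in \<open>simp_all add: Pi_iff bracket_closed\<close>)

lemma (in lie_algebra) lie_eval_cong:
  assumes g: "g \<in> \<Lambda> \<rightarrow> carrier M" and "lie_cong R \<Lambda> s t"
  shows "lie_eval M g s = lie_eval M g t"
  using assms(2)
proof induction
  case (add_comm s t)
  then show ?case by (simp add: lie_eval_closed[OF g] M.a_comm)
qed (simp_all add: lie_eval_closed[OF g] bracket_closed M.a_assoc M.l_neg smult_l_distr
      smult_r_distr smult_assoc1 bracket_add_left bracket_add_right bracket_smult_left
      bracket_smult_right bracket_self jacobi)

lemma (in lie_algebra) lie_hom_lie_class: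
  assumes f: "f \<in> lie_hom R (free_lie R \<Lambda>) M" and g: "g \<in> \<Lambda> \<rightarrow> carrier M"
    and fg: "\<And>x. x \<in> \<Lambda> \<Longrightarrow> f (free_lie_gen R \<Lambda> x) = g x"
    and t: "t \<in> lie_exprs R \<Lambda>"
  shows "f (lie_class R \<Lambda> t) = lie_eval M g t"
proof -
  note K = R.is_cring
  have car: "f (lie_class R \<Lambda> t) \<in> carrier M" if "t \<in> lie_exprs R \<Lambda>" for t
    using f that by (auto simp: lie_hom_def free_lie_carrier)
  have add: "f (lie_class R \<Lambda> (Add s t)) = f (lie_class R \<Lambda> s) \<oplus>\<^bsub>M\<^esub> f (lie_class R \<Lambda> t)"
    and brk: "f (lie_class R \<Lambda> (Bracket s t)) = f (lie_class R \<Lambda> s) \<otimes>\<^bsub>M\<^esub> f (lie_class R \<Lambda> t)"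
    if "s \<in> lie_exprs R \<Lambda>" "t \<in> lie_exprs R \<Lambda>" for s t
    using f that by (simp_all add: lie_hom_def free_lie_carrier
        flip: free_lie_add[OF K] free_lie_bracket[OF K])
  have scl: "f (lie_class R \<Lambda> (Scale a t)) = a \<odot>\<^bsub>M\<^esub> f (lie_class R \<Lambda> t)"
    if "a \<in> carrier R" "t \<in> lie_exprs R \<Lambda>" for a t
    using f that by (simp add: lie_hom_def free_lie_carrier flip: free_lie_smult[OF K])
  have zero: "f (lie_class R \<Lambda> Zero) = \<zero>\<^bsub>M\<^esub>"
  proof -
    have "lie_class R \<Lambda> (Add Zero Zero) = lie_class R \<Lambda> Zero"
      by (intro lie_class_eqI[OF K] lie_cong.add_zero lie_exprs.Zero)
    with add[OF lie_exprs.Zero lie_exprs.Zero] car[OF lie_exprs.Zero] show ?thesis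
      by (metis M.add.r_cancel_one')
  qed
  show ?thesis
    using t
  proof induction
    case (Gen x)
    then show ?case using fg by (simp add: free_lie_gen_def)
  next
    case (Neg t)
    have "lie_class R \<Lambda> (Add (Neg t) t) = lie_class R \<Lambda> Zero"
      by (intro lie_class_eqI[OF K] lie_cong.add_neg Neg)
    then have "f (lie_class R \<Lambda> (Neg t)) \<oplus>\<^bsub>M\<^esub> f (lie_class R \<Lambda> t) = \<zero>\<^bsub>M\<^esub>"
      using add[OF lie_exprs.Neg[OF Neg(1)] Neg(1)] zero by simp
    then show ?case
      using Neg car lie_exprs.Neg M.minus_equality by fastforce
  qed (simp_all add: zero add scl brk)
qed

theorem free_lie_universal:
  assumes "lie_algebra K M" and g: "g \<in> \<Lambda> \<rightarrow> carrier M"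
  shows "\<exists>!f. f \<in> lie_hom K (free_lie K \<Lambda>) M \<and> f \<in> extensional (carrier (free_lie K \<Lambda>)) \<and>
      (\<forall>x\<in>\<Lambda>. f (free_lie_gen K \<Lambda> x) = g x)"
proof -
  interpret lie_algebra K M by fact
  note K = R.is_cring
  define f where "f = (\<lambda>A\<in>carrier (free_lie K \<Lambda>). lie_eval M g (SOME t. t \<in> lie_exprs K \<Lambda> \<and> lie_class K \<Lambda> t = A))"
  have f: "f (lie_class K \<Lambda> t) = lie_eval M g t" if t: "t \<in> lie_exprs K \<Lambda>" for t
  proof -
    let ?s = "SOME s. s \<in> lie_exprs K \<Lambda> \<and> lie_class K \<Lambda> s = lie_class K \<Lambda> t"
    have s: "?s \<in> lie_exprs K \<Lambda> \<and> lie_class K \<Lambda> ?s = lie_class K \<Lambda> t"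
      by (rule someI[of _ t]) (simp add: t)
    then have "lie_cong K \<Lambda> ?s t"
      using lie_class_eq_iff[OF K] t by blast
    then show ?thesis
      using lie_eval_cong[OF g] t by (simp add: f_def free_lie_carrier)
  qed
  show ?thesis
  proof (rule ex1I[of _ f], intro conjI ballI)
    show "f \<in> lie_hom K (free_lie K \<Lambda>) M"
      using lie_eval_closed[OF g]
      by (auto simp: lie_hom_def free_lie_carrier f free_lie_add[OF K] free_lie_bracket[OF K]
          free_lie_smult[OF K] lie_exprs.intros)
    show "f \<in> extensional (carrier (free_lie K \<Lambda>))"
      by (simp add: f_def)
    show "f (free_lie_gen K \<Lambda> x) = g x" if "x \<in> \<Lambda>" for x
      using that f[of "Gen x"] by (simp add: free_lie_gen_def lie_exprs.intros)
  next
    fix h assume h: "h \<in> lie_hom K (free_lie K \<Lambda>) M \<and> h \<in> extensional (carrier (free_lie K \<Lambda>)) \<and>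
      (\<forall>x\<in>\<Lambda>. h (free_lie_gen K \<Lambda> x) = g x)"
    show "h = f"
    proof (rule extensionalityI)
      show "h \<in> extensional (carrier (free_lie K \<Lambda>))" using h by blast
      show "f \<in> extensional (carrier (free_lie K \<Lambda>))" by (simp add: f_def)
      show "h A = f A" if "A \<in> carrier (free_lie K \<Lambda>)" for A
      proof -
        obtain t where t: "t \<in> lie_exprs K \<Lambda>" "A = lie_class K \<Lambda> t"
          using \<open>A \<in> carrier (free_lie K \<Lambda>)\<close> by (auto simp: free_lie_carrier)
        have "h (lie_class K \<Lambda> t) = lie_eval M g t"
          by (rule lie_hom_lie_class[OF _ g _ t(1)]) (use h in blast)+
        then show ?thesis by (simp only: t f)
      qed
    qed
  qed
qed


section \<open>Noncommutative polynomials\<close>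

text \<open>
  A noncommutative polynomial is its finitely supported coefficient function on words over \<open>\<Lambda>\<close>.
  The coefficient of a product at \<open>w\<close> sums over the \<open>length w + 1\<close> ways to cut \<open>w\<close> in two.
\<close>

definition free_assoc :: "('k, 'r) ring_scheme \<Rightarrow> 'x set \<Rightarrow> ('k, 'x list \<Rightarrow> 'k) module" where
  "free_assoc K \<Lambda> = \<lparr>
     carrier = {f. (\<forall>w. f w \<in> carrier K) \<and> (\<forall>w. w \<notin> lists \<Lambda> \<longrightarrow> f w = \<zero>\<^bsub>K\<^esub>) \<and>
       finite {w. f w \<noteq> \<zero>\<^bsub>K\<^esub>}},
     mult = (\<lambda>f g w. \<Oplus>\<^bsub>K\<^esub>i\<in>{..length w}. f (take i w) \<otimes>\<^bsub>K\<^esub> g (drop i w)),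
     one = (\<lambda>w. if w = [] then \<one>\<^bsub>K\<^esub> else \<zero>\<^bsub>K\<^esub>),
     zero = (\<lambda>w. \<zero>\<^bsub>K\<^esub>),
     add = (\<lambda>f g w. f w \<oplus>\<^bsub>K\<^esub> g w),
     smult = (\<lambda>a f w. a \<otimes>\<^bsub>K\<^esub> f w)\<rparr>"

definition free_assoc_gen :: "('k, 'r) ring_scheme \<Rightarrow> 'x \<Rightarrow> 'x list \<Rightarrow> 'k" where
  "free_assoc_gen K x = (\<lambda>w. if w = [x] then \<one>\<^bsub>K\<^esub> else \<zero>\<^bsub>K\<^esub>)"

context cring
begin

definition conv :: "('x list \<Rightarrow> 'a) \<Rightarrow> ('x list \<Rightarrow> 'a) \<Rightarrow> 'x list \<Rightarrow> 'a" where
  "conv f g w = (\<Oplus>i\<in>{..length w}. f (take i w) \<otimes> g (drop i w))"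

lemma conv_Nil:
  assumes "range f \<subseteq> carrier R" "range g \<subseteq> carrier R"
  shows "conv f g [] = f [] \<otimes> g []"
  using assms by (simp add: conv_def image_subset_iff)

lemma conv_Cons:
  assumes f: "range f \<subseteq> carrier R" and g: "range g \<subseteq> carrier R"
  shows "conv f g (x # w) = conv (\<lambda>v. f (x # v)) g w \<oplus> f [] \<otimes> g (x # w)"
proof -
  have "(\<lambda>i. f (take i (x # w)) \<otimes> g (drop i (x # w))) \<in> {..Suc (length w)} \<rightarrow> carrier R"
    using f g by (auto simp: image_subset_iff)
  from finsum_Suc2[OF this] show ?thesis
    by (simp add: conv_def)
qed

lemma conv_closed:
  assumes "range f \<subseteq> carrier R" "range g \<subseteq> carrier R"
  shows "conv f g w \<in> carrier R"
  unfolding conv_def using assms by (intro finsum_closed) (auto simp: image_subset_iff)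

lemma conv_add_left:
  assumes "range f \<subseteq> carrier R" "range g \<subseteq> carrier R" "range h \<subseteq> carrier R"
  shows "conv (\<lambda>w. f w \<oplus> g w) h w = conv f h w \<oplus> conv g h w"
  unfolding conv_def using assms
  by (subst finsum_addf[symmetric]) (auto intro!: finsum_cong' simp: l_distr image_subset_iff)

lemma conv_add_right:
  assumes "range f \<subseteq> carrier R" "range g \<subseteq> carrier R" "range h \<subseteq> carrier R"
  shows "conv f (\<lambda>w. g w \<oplus> h w) w = conv f g w \<oplus> conv f h w"
  unfolding conv_def using assms
  by (subst finsum_addf[symmetric]) (auto intro!: finsum_cong' simp: r_distr image_subset_iff)

lemma conv_smult_left:
  assumes "a \<in> carrier R" "range f \<subseteq> carrier R" "range g \<subseteq> carrier R"
  shows "conv (\<lambda>w. a \<otimes> f w) g w = a \<otimes> conv f g w"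
  unfolding conv_def using assms
  by (subst finsum_rdistr) (auto intro!: finsum_cong' simp: m_assoc image_subset_iff)

lemma conv_smult_right:
  assumes "a \<in> carrier R" "range f \<subseteq> carrier R" "range g \<subseteq> carrier R"
  shows "conv f (\<lambda>w. a \<otimes> g w) w = a \<otimes> conv f g w"
  unfolding conv_def using assms
  by (subst finsum_rdistr) (auto intro!: finsum_cong' simp: m_lcomm image_subset_iff)

lemma conv_assoc:
  assumes "range f \<subseteq> carrier R" "range g \<subseteq> carrier R" "range h \<subseteq> carrier R"
  shows "conv (conv f g) h w = conv f (conv g h) w"
  using assms
proof (induction w arbitrary: f g h)
  case Nil
  then show ?case
    by (subst (1 2) conv_Nil) (auto simp: conv_Nil conv_closed m_assoc image_subset_iff)
next
  case (Cons x w)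
  note f = Cons.prems(1) and g = Cons.prems(2) and h = Cons.prems(3)
  let ?fx = "\<lambda>v. f (x # v)" and ?gx = "\<lambda>v. g (x # v)"
  have fx: "range ?fx \<subseteq> carrier R" and gx: "range ?gx \<subseteq> carrier R" and f0: "f [] \<in> carrier R"
    and g0: "g [] \<in> carrier R" and hx: "h (x # w) \<in> carrier R"
    using f g h by auto
  have fgx: "range (conv ?fx g) \<subseteq> carrier R" "range (\<lambda>v. f [] \<otimes> ?gx v) \<subseteq> carrier R"
    "range (conv f g) \<subseteq> carrier R" "range (conv g h) \<subseteq> carrier R"
    using f0 gx by (auto simp: image_subset_iff
        intro!: conv_closed[OF fx g] conv_closed[OF f g] conv_closed[OF g h])
  have "conv (conv f g) h (x # w) =
      conv (\<lambda>v. conv ?fx g v \<oplus> f [] \<otimes> ?gx v) h w \<oplus> (f [] \<otimes> g []) \<otimes> h (x # w)"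
    by (simp add: conv_Cons[OF fgx(3) h] conv_Cons[OF f g] conv_Nil[OF f g])
  also have "\<dots> = conv (conv ?fx g) h w \<oplus> f [] \<otimes> conv ?gx h w \<oplus> (f [] \<otimes> g []) \<otimes> h (x # w)"
    by (simp add: conv_add_left[OF fgx(1,2) h] conv_smult_left[OF f0 gx h])
  also have "conv (conv ?fx g) h w = conv ?fx (conv g h) w"
    by (rule Cons.IH[OF fx g h])
  also have "conv ?fx (conv g h) w \<oplus> f [] \<otimes> conv ?gx h w \<oplus> (f [] \<otimes> g []) \<otimes> h (x # w) =
      conv ?fx (conv g h) w \<oplus> f [] \<otimes> (conv ?gx h w \<oplus> g [] \<otimes> h (x # w))"
    using conv_closed[OF fx fgx(4)] conv_closed[OF gx h] f0 g0 hx
    by (simp add: a_assoc m_assoc r_distr)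
  also have "\<dots> = conv f (conv g h) (x # w)"
    by (simp add: conv_Cons[OF f fgx(4)] conv_Cons[OF g h])
  finally show ?case .
qed

lemma conv_one_left:
  assumes "range f \<subseteq> carrier R"
  shows "conv (\<lambda>w. if w = [] then \<one> else \<zero>) f w = f w"
proof (cases w)
  case Nil
  then show ?thesis using assms by (simp add: conv_def image_subset_iff)
next
  case (Cons x v)
  have "conv (\<lambda>u. if x # u = [] then \<one> else \<zero>) f v = \<zero>"
    unfolding conv_def using assms by (subst finsum_cong'[where g = "\<lambda>_. \<zero>"]) (auto simp: image_subset_iff)
  then show ?thesis
    using Cons assms conv_Cons[of "\<lambda>w. if w = [] then \<one> else \<zero>" f x v]
    by (auto simp: image_subset_iff)
qed

lemma conv_one_right:
  assumes "range f \<subseteq> carrier R"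
  shows "conv f (\<lambda>w. if w = [] then \<one> else \<zero>) w = f w"
  using assms
proof (induction w arbitrary: f)
  case Nil
  then show ?case by (simp add: conv_def image_subset_iff)
next
  case (Cons x w)
  have "range (\<lambda>v. f (x # v)) \<subseteq> carrier R" using Cons.prems by auto
  with Cons show ?case
    by (subst conv_Cons) (auto simp: image_subset_iff)
qed

lemma assoc_algebra_free_assoc:
  fixes \<Lambda> :: "'x set"
  shows "assoc_algebra R (free_assoc R \<Lambda>)"
proof -
  let ?A = "free_assoc R \<Lambda>"
  let ?supp = "\<lambda>f :: 'x list \<Rightarrow> 'a. {w. f w \<noteq> \<zero>}"
  have ops: "f \<oplus>\<^bsub>?A\<^esub> g = (\<lambda>w. f w \<oplus> g w)" "f \<otimes>\<^bsub>?A\<^esub> g = conv f g" "\<zero>\<^bsub>?A\<^esub> = (\<lambda>w. \<zero>)"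
    "\<one>\<^bsub>?A\<^esub> = (\<lambda>w. if w = [] then \<one> else \<zero>)" "a \<odot>\<^bsub>?A\<^esub> f = (\<lambda>w. a \<otimes> f w)" for f g a
    by (simp_all add: free_assoc_def conv_def fun_eq_iff)
  have car: "f \<in> carrier ?A \<longleftrightarrow> (\<forall>w. f w \<in> carrier R) \<and> (\<forall>w. w \<notin> lists \<Lambda> \<longrightarrow> f w = \<zero>) \<and> finite (?supp f)"
    for f by (simp add: free_assoc_def)
  have rng: "f \<in> carrier ?A \<Longrightarrow> range f \<subseteq> carrier R" and
    cl: "f \<in> carrier ?A \<Longrightarrow> f w \<in> carrier R" for f w
    by (auto simp: car)
  have add_closed: "(\<lambda>w. f w \<oplus> g w) \<in> carrier ?A" if "f \<in> carrier ?A" "g \<in> carrier ?A" for f g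
  proof -
    have "?supp (\<lambda>w. f w \<oplus> g w) \<subseteq> ?supp f \<union> ?supp g" by auto
    with that show ?thesis
      by (auto simp: car intro: finite_subset)
  qed
  have smult_closed: "(\<lambda>w. a \<otimes> f w) \<in> carrier ?A" if "a \<in> carrier R" "f \<in> carrier ?A" for a f
  proof -
    have "?supp (\<lambda>w. a \<otimes> f w) \<subseteq> ?supp f" using that by auto
    with that show ?thesis
      by (auto simp: car intro: finite_subset)
  qed
  have mult_closed: "conv f g \<in> carrier ?A" if f: "f \<in> carrier ?A" and g: "g \<in> carrier ?A" for f g
  proof -
    have nz: "\<exists>u v. w = u @ v \<and> f u \<noteq> \<zero> \<and> g v \<noteq> \<zero>" if w: "conv f g w \<noteq> \<zero>" for w
    proof (rule ccontr)
      assume *: "\<not> ?thesis"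
      have "f (take i w) \<otimes> g (drop i w) = \<zero>" for i
        using * cl[OF f] cl[OF g] by (metis append_take_drop_id l_null r_null)
      with w show False by (simp add: conv_def)
    qed
    have "?supp (conv f g) \<subseteq> (\<lambda>(u, v). u @ v) ` (?supp f \<times> ?supp g)"
      using nz by fastforce
    moreover have "finite (?supp f \<times> ?supp g)" using f g by (simp add: car)
    ultimately have "finite (?supp (conv f g))" by (metis finite_imageI finite_subset)
    moreover have "conv f g w = \<zero>" if "w \<notin> lists \<Lambda>" for w
    proof (rule ccontr)
      assume "conv f g w \<noteq> \<zero>"
      then obtain u v where "w = u @ v" "f u \<noteq> \<zero>" "g v \<noteq> \<zero>" using nz by blast
      with f g that show False by (auto simp: car)
    qed
    ultimately show ?thesis
      using conv_closed[OF rng[OF f] rng[OF g]] by (simp add: car)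
  qed
  have one_closed: "\<one>\<^bsub>?A\<^esub> \<in> carrier ?A"
  proof -
    have "?supp \<one>\<^bsub>?A\<^esub> \<subseteq> {[]}" by (auto simp: ops)
    then have "finite (?supp \<one>\<^bsub>?A\<^esub>)" by (rule finite_subset) simp
    then show ?thesis by (simp add: car) (auto simp: ops)
  qed
  have ab: "abelian_group ?A"
  proof (rule abelian_groupI)
    show "\<exists>g\<in>carrier ?A. g \<oplus>\<^bsub>?A\<^esub> f = \<zero>\<^bsub>?A\<^esub>" if f: "f \<in> carrier ?A" for f
    proof
      show "(\<lambda>w. \<ominus> \<one> \<otimes> f w) \<in> carrier ?A" using f by (intro smult_closed) auto
      show "(\<lambda>w. \<ominus> \<one> \<otimes> f w) \<oplus>\<^bsub>?A\<^esub> f = \<zero>\<^bsub>?A\<^esub>"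
        using cl[OF f] by (auto simp: ops l_minus l_neg)
    qed
    show "\<zero>\<^bsub>?A\<^esub> \<in> carrier ?A" by (simp add: car) (simp add: ops)
  qed (auto simp: ops add_closed add.m_ac cl)
  have "monoid ?A"
    by (rule monoidI)
      (use one_closed in \<open>auto simp: ops mult_closed fun_eq_iff conv_assoc rng
        conv_one_left conv_one_right\<close>)
  then have rg: "ring ?A"
    by (intro ringI ab)
      (auto simp: ops fun_eq_iff conv_add_left conv_add_right rng)
  have md: "module R ?A"
    by (rule moduleI[OF is_cring ab])
      (auto simp: ops smult_closed cl l_distr r_distr m_assoc)
  show ?thesis
    by (intro assoc_algebra.intro md rg assoc_algebra_axioms.intro)
      (auto simp: ops conv_smult_left conv_smult_right rng)
qed

lemma free_assoc_gen_closed: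
  assumes "x \<in> \<Lambda>"
  shows "free_assoc_gen R x \<in> carrier (free_assoc R \<Lambda>)"
proof -
  have "{w. free_assoc_gen R x w \<noteq> \<zero>} \<subseteq> {[x]}" by (auto simp: free_assoc_gen_def)
  then have "finite {w. free_assoc_gen R x w \<noteq> \<zero>}" by (rule finite_subset) simp
  with assms show ?thesis by (auto simp: free_assoc_def free_assoc_gen_def split: if_splits)
qed

end


section \<open>Commutator-evaluation\<close>

text \<open>
  The unique homomorphism of Lie algebras that maps generators to generators; uniqueness is among
  functions with the value \<^term>\<open>undefined\<close> outside the carrier.
\<close>

definition commutator_evaluation ::
  "('k, 'r) ring_scheme \<Rightarrow> 'x set \<Rightarrow> ('k, 'x) lie_expr set \<Rightarrow> 'x list \<Rightarrow> 'k"
where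
  "commutator_evaluation K \<Lambda> = (THE f.
     f \<in> lie_hom K (free_lie K \<Lambda>) (commutator_lie (free_assoc K \<Lambda>)) \<and>
     f \<in> extensional (carrier (free_lie K \<Lambda>)) \<and>
     (\<forall>x\<in>\<Lambda>. f (free_lie_gen K \<Lambda> x) = free_assoc_gen K x))"

lemma commutator_evaluation_ex1:
  assumes "cring K"
  shows "\<exists>!f. f \<in> lie_hom K (free_lie K \<Lambda>) (commutator_lie (free_assoc K \<Lambda>)) \<and>
     f \<in> extensional (carrier (free_lie K \<Lambda>)) \<and>
     (\<forall>x\<in>\<Lambda>. f (free_lie_gen K \<Lambda> x) = free_assoc_gen K x)"
  using assms
  by (intro free_lie_universal assoc_algebra.commutator_lie_algebra cring.assoc_algebra_free_assoc)
    (auto intro: cring.free_assoc_gen_closed)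

lemmas commutator_evaluation =
  theI'[OF commutator_evaluation_ex1, folded commutator_evaluation_def]

end

theory Submission
  imports Defs
begin

text \<open>
  Order the generators linearly and compare words lexicographically, a proper prefix being smaller.
  The Hall trees are the standard bracketings of Lyndon words, and each is determined by its word.
  Antisymmetry and the Jacobi identity rewrite a bracket of two Hall trees as a linear combination of
  Hall trees, so Hall trees span every Lie algebra generated by the letters, over any coefficient
  ring. In the noncommutative polynomials a Hall tree evaluates to its own word, with coefficient
  \<open>1\<close>, plus larger words of the same length. Hence in a combination of Hall trees that evaluates
  to \<open>0\<close> the coefficient of the tree with the least word vanishes, and so on for the remaining trees.
\<close>

section \<open>Lyndon words and Hall trees\<close>

locale letter_order =
  fixes r :: "('x \<times> 'x) set"
  assumes trans_r: "trans r" and irrefl_r: "irrefl r" and total_r: "total r"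
begin

abbreviation less_word :: "'x list \<Rightarrow> 'x list \<Rightarrow> bool" (infix "\<prec>" 50) where
  "u \<prec> v \<equiv> (u, v) \<in> lexord r"

abbreviation leq_word :: "'x list \<Rightarrow> 'x list \<Rightarrow> bool" (infix "\<preceq>" 50) where
  "u \<preceq> v \<equiv> u = v \<or> u \<prec> v"

lemma less_word_irrefl: "\<not> u \<prec> u"
  using irrefl_r by (simp add: irrefl_def lexord_irreflexive)

lemma less_word_trans: "u \<prec> v \<Longrightarrow> v \<prec> w \<Longrightarrow> u \<prec> w"
  using trans_r lexord_trans by blast

lemma less_word_linear: "u \<prec> v \<or> u = v \<or> v \<prec> u"
  using total_r lexord_linear[of r u v] by (auto simp: total_on_def)

lemma less_word_append: "v \<noteq> [] \<Longrightarrow> u \<prec> u @ v"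
  by (cases v) (auto intro: lexord_append_rightI)

text \<open>Words of equal length that differ are separated at a letter, never by one being a prefix
  of the other, so whatever is appended cannot change their order.\<close>

lemma append_leq_word:
  assumes "length u = length u'" "u \<preceq> u'" "v \<preceq> v'"
  shows "u @ v \<preceq> u' @ v'"
  using assms lexord_append_leftI[of v v' r u] lexord_sufI[of u u' r v v'] by auto

lemma finite_has_least_word:
  assumes "finite A" "A \<noteq> {}"
  shows "\<exists>a\<in>A. \<forall>b\<in>A. f a \<preceq> f b"
  using assms
proof (induction rule: finite_ne_induct)
  case (insert a A)
  then obtain b where "b \<in> A" "\<forall>c\<in>A. f b \<preceq> f c" by blast
  then show ?case
    using less_word_linear[of "f a" "f b"] less_word_trans by (metis insert_iff)
qed simp

definition lyndon :: "'x list \<Rightarrow> bool" where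
  "lyndon w \<longleftrightarrow> w \<noteq> [] \<and> (\<forall>u v. w = u @ v \<and> u \<noteq> [] \<and> v \<noteq> [] \<longrightarrow> w \<prec> v)"

text \<open>If \<open>v = u @ v'\<close>, the Lyndon property gives \<open>v\<close> <
  \<open>v'\<close>, and prefixing \<open>u\<close> to both sides gives the claim. Otherwise
  \<open>u\<close> and \<open>v\<close> differ at some letter, which also decides between
  \<open>u @ v\<close> and \<open>v\<close>.\<close>

lemma lyndon_append_less:
  assumes v: "lyndon v" and u: "u \<noteq> []" and uv: "u \<prec> v"
  shows "u @ v \<prec> v"
proof -
  consider a v' where "v = u @ a # v'"
    | p a b x y where "(a, b) \<in> r" "u = p @ a # x" "v = p @ b # y"
    using uv by (auto simp: lexord_def)
  then show ?thesis
  proof cases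
    case 1
    then have "v \<prec> a # v'" using v u by (simp add: lyndon_def)
    then have "u @ v \<prec> u @ a # v'" by (rule lexord_append_leftI)
    then show ?thesis using 1 by simp
  next
    case 2
    then show ?thesis by (simp add: lexord_append_left_rightI)
  qed
qed

text \<open>This is what makes the first product of a commutator of Hall trees carry the smaller
  leading word.\<close>

lemma lyndon_append_swap:
  assumes "lyndon v" "u \<noteq> []" "u \<prec> v"
  shows "u @ v \<prec> v @ u"
  using lyndon_append_less[OF assms] less_word_append[OF assms(2)] less_word_trans by blast

end

text \<open>Hall trees consist of generators and brackets; \<open>[]\<close> is a dummy value on the
  other constructors.\<close>

fun foliage :: "('k, 'x) lie_expr \<Rightarrow> 'x list" where
  "foliage (Gen x) = [x]"
| "foliage (Bracket s t) = foliage s @ foliage t"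
| "foliage _ = []"

text \<open>The last premise of \<open>Bracket\<close> makes the bracket the standard factorization of its foliage.\<close>

inductive_set hall :: "('x \<times> 'x) set \<Rightarrow> 'x set \<Rightarrow> ('k, 'x) lie_expr set"
  for r :: "('x \<times> 'x) set" and \<Lambda> :: "'x set"
where
  Gen: "x \<in> \<Lambda> \<Longrightarrow> Gen x \<in> hall r \<Lambda>"
| Bracket: "\<lbrakk>s \<in> hall r \<Lambda>; t \<in> hall r \<Lambda>; (foliage s, foliage t) \<in> lexord r;
    \<And>x y. s = Bracket x y \<Longrightarrow> (foliage y, foliage t) \<notin> lexord r\<rbrakk> \<Longrightarrow>
    Bracket s t \<in> hall r \<Lambda>"

inductive_cases hall_BracketE: "Bracket s t \<in> hall r \<Lambda>"

lemma hall_lie_exprs: "t \<in> hall r \<Lambda> \<Longrightarrow> t \<in> lie_exprs K \<Lambda>"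
  by (induction rule: hall.induct) (auto intro: lie_exprs.intros)

lemma foliage_hall_nonempty: "t \<in> hall r \<Lambda> \<Longrightarrow> foliage t \<noteq> []"
  by (induction rule: hall.induct) auto

section \<open>Hall trees are determined by their words\<close>

context letter_order
begin

text \<open>The right child of a Hall tree is recovered from the foliage as its least proper suffix.\<close>

lemma hall_lyndon_least_suffix:
  assumes "h \<in> hall r \<Lambda>"
  shows "lyndon (foliage h) \<and>
    (\<forall>s t u v. h = Bracket s t \<and> foliage h = u @ v \<and> u \<noteq> [] \<and> v \<noteq> [] \<longrightarrow> foliage t \<preceq> v)"
  using assms
proof (induction rule: hall.induct)
  case (Gen x)
  then show ?case by (auto simp: lyndon_def Cons_eq_append_conv)
next
  case (Bracket s t)
  have ne: "foliage s \<noteq> []" "foliage t \<noteq> []"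
    using Bracket.hyps foliage_hall_nonempty by blast+
  \<comment> \<open>The suffix \<open>v\<close> lies within \<open>foliage t\<close>, where the
    Lyndon property of \<open>t\<close> applies, or the cut is strictly inside
    \<open>foliage s = u @ p\<close>. Then \<open>s\<close> cannot be a generator, and with
    \<open>s = Bracket x y\<close> the chain is \<open>foliage t\<close> <= \<open>foliage y\<close>
    <= \<open>p\<close> < \<open>v\<close>: the last premise of \<open>hall\<close>, the induction
    hypothesis, and the prefix rule.\<close>
  have suffix: "foliage t \<preceq> v"
    if uv: "foliage s @ foliage t = u @ v" "u \<noteq> []" "v \<noteq> []" for u v
  proof -
    from uv(1) consider p where "foliage t = p @ v"
      | p where "foliage s = u @ p" "p \<noteq> []" "v = p @ foliage t"
      unfolding append_eq_append_conv2 by (metis append_Nil append_Nil2)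
    then show ?thesis
    proof cases
      case (1 p)
      then show ?thesis using Bracket.IH(2) uv(3) unfolding lyndon_def by (cases "p = []") auto
    next
      case (2 p)
      obtain x y where s: "s = Bracket x y"
        using Bracket.hyps(1) 2 uv(2) by cases (auto simp: Cons_eq_append_conv)
      have "foliage y \<preceq> p" using Bracket.IH(1) s 2 uv(2) by blast
      moreover have "foliage t \<preceq> foliage y"
        using Bracket.hyps(4)[OF s] less_word_linear by blast
      moreover have "p \<prec> v" using 2 ne by (simp add: less_word_append)
      ultimately show ?thesis using less_word_trans by metis
    qed
  qed
  have "foliage s @ foliage t \<prec> foliage t"
    using lyndon_append_less Bracket.IH(2) ne Bracket.hyps(3) by blast
  then have "lyndon (foliage (Bracket s t))"
    using suffix ne less_word_trans unfolding lyndon_def by (metis append_is_Nil_conv foliage.simps(2))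
  then show ?case using suffix by auto
qed

lemmas hall_lyndon = hall_lyndon_least_suffix[THEN conjunct1]

lemma foliage_right_leq:
  assumes "Bracket s t \<in> hall r \<Lambda>" "foliage s @ foliage t = u @ v" "u \<noteq> []" "v \<noteq> []"
  shows "foliage t \<preceq> v"
  using hall_lyndon_least_suffix[OF assms(1)] assms(2-) by auto

text \<open>The words of the two right children are both least proper suffixes of the same word,
  hence equal. Cancelling them leaves equal words for the left children, and induction applies to
  both pairs.\<close>

lemma foliage_hall_inj:
  assumes "h \<in> hall r \<Lambda>" "h' \<in> hall r \<Lambda>" "foliage h = foliage h'"
  shows "h = h'"
  using assms
proof (induction arbitrary: h' rule: hall.induct)
  case (Gen x)
  from Gen(2) show ?case
    using Gen(3) by cases (auto simp: Cons_eq_append_conv dest: foliage_hall_nonempty)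
next
  case (Bracket s t)
  from Bracket.prems(1) show ?case
  proof cases
    case (Gen x)
    with Bracket show ?thesis
      by (auto simp: append_eq_Cons_conv dest: foliage_hall_nonempty)
  next
    case (Bracket s' t')
    note h' = this
    have st: "Bracket s t \<in> hall r \<Lambda>" "Bracket s' t' \<in> hall r \<Lambda>"
      using Bracket.hyps Bracket.prems h' by (auto intro: hall.intros)
    have eq: "foliage s @ foliage t = foliage s' @ foliage t'"
      using Bracket.prems h' by simp
    have "foliage t \<preceq> foliage t'" "foliage t' \<preceq> foliage t"
      using foliage_right_leq[OF st(1) eq] foliage_right_leq[OF st(2) eq[symmetric]]
        foliage_hall_nonempty Bracket.hyps h' by blast+
    then have "foliage t = foliage t'" using less_word_trans less_word_irrefl by metis
    with eq show ?thesis using Bracket.IH h' by auto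
  qed
qed

end


section \<open>Hall trees span\<close>

context module
begin

text \<open>Combinations grow one term at a time, so that closure properties follow by induction;
  the same element of \<open>S\<close> may occur in several terms.\<close>

inductive_set lspan :: "'c set \<Rightarrow> 'c set" for S where
  zero: "\<zero>\<^bsub>M\<^esub> \<in> lspan S"
| step: "\<lbrakk>a \<in> carrier R; s \<in> S; x \<in> lspan S\<rbrakk> \<Longrightarrow> a \<odot>\<^bsub>M\<^esub> s \<oplus>\<^bsub>M\<^esub> x \<in> lspan S"

lemma lspan_closed: "x \<in> lspan S \<Longrightarrow> S \<subseteq> carrier M \<Longrightarrow> x \<in> carrier M"
  by (induction rule: lspan.induct) auto

lemma lspan_mono: "x \<in> lspan S \<Longrightarrow> S \<subseteq> T \<Longrightarrow> x \<in> lspan T"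
  by (induction rule: lspan.induct) (auto intro: lspan.intros)

lemma lspan_base: "s \<in> S \<Longrightarrow> S \<subseteq> carrier M \<Longrightarrow> s \<in> lspan S"
  using lspan.step[of \<one> s S "\<zero>\<^bsub>M\<^esub>"] by (auto simp: subset_iff intro: lspan.zero)

lemma lspan_add:
  assumes "x \<in> lspan S" "y \<in> lspan S" "S \<subseteq> carrier M"
  shows "x \<oplus>\<^bsub>M\<^esub> y \<in> lspan S"
  using assms
  by (induction rule: lspan.induct) (auto simp: lspan_closed M.a_assoc subset_iff intro: lspan.step)

lemma lspan_smult:
  assumes "x \<in> lspan S" "a \<in> carrier R" "S \<subseteq> carrier M"
  shows "a \<odot>\<^bsub>M\<^esub> x \<in> lspan S"
  using assms
proof (induction rule: lspan.induct)
  case (step b s x)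
  then have "a \<odot>\<^bsub>M\<^esub> (b \<odot>\<^bsub>M\<^esub> s \<oplus>\<^bsub>M\<^esub> x) = (a \<otimes> b) \<odot>\<^bsub>M\<^esub> s \<oplus>\<^bsub>M\<^esub> a \<odot>\<^bsub>M\<^esub> x"
    by (simp add: smult_r_distr smult_assoc1 lspan_closed subset_iff)
  with step show ?case by (simp add: lspan.step)
qed (simp add: lspan.zero)

lemma lspan_minus:
  assumes "x \<in> lspan S" "S \<subseteq> carrier M"
  shows "\<ominus>\<^bsub>M\<^esub> x \<in> lspan S"
  using lspan_smult[OF assms(1) _ assms(2), of "\<ominus> \<one>"] lspan_closed[OF assms]
  by (simp add: smult_l_minus)

text \<open>Each step of the construction uses one element. The span is taken over an image so that
  \<open>F\<close> is a finite set of indices, later of Hall trees.\<close>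

lemma lspan_finite:
  assumes "x \<in> lspan (f ` A)"
  shows "\<exists>F. finite F \<and> F \<subseteq> A \<and> x \<in> lspan (f ` F)"
  using assms
proof (induction rule: lspan.induct)
  case zero
  show ?case by (intro exI[of _ "{}"]) (simp add: lspan.zero)
next
  case (step a s x)
  then obtain F h where F: "finite F" "F \<subseteq> A" "x \<in> lspan (f ` F)" and h: "h \<in> A" "s = f h"
    by blast
  have "x \<in> lspan (f ` insert h F)" by (rule lspan_mono[OF F(3)]) auto
  with step.hyps F h show ?case
    by (intro exI[of _ "insert h F"]) (auto intro!: lspan.step)
qed

text \<open>Terms at \<open>s\<close> are merged into one coefficient and all others stay in the
  remainder. This isolates the coefficient of the tree with the least word.\<close>

lemma lspan_insert:
  assumes "x \<in> lspan (insert s S)" "insert s S \<subseteq> carrier M"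
  shows "\<exists>a\<in>carrier R. \<exists>y\<in>lspan S. x = a \<odot>\<^bsub>M\<^esub> s \<oplus>\<^bsub>M\<^esub> y"
  using assms(1)
proof (induction rule: lspan.induct)
  case zero
  show ?case
    using assms(2) by (intro bexI[of _ \<zero>] bexI[of _ "\<zero>\<^bsub>M\<^esub>"]) (auto intro: lspan.zero)
next
  case (step b u x)
  then obtain a y where a: "a \<in> carrier R" and y: "y \<in> lspan S" and x: "x = a \<odot>\<^bsub>M\<^esub> s \<oplus>\<^bsub>M\<^esub> y"
    by blast
  have cl: "s \<in> carrier M" "u \<in> carrier M" "y \<in> carrier M"
    using assms(2) step.hyps lspan_closed[OF y] by auto
  show ?case
  proof (cases "u = s")
    case True
    then have "b \<odot>\<^bsub>M\<^esub> u \<oplus>\<^bsub>M\<^esub> x = (b \<oplus> a) \<odot>\<^bsub>M\<^esub> s \<oplus>\<^bsub>M\<^esub> y"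
      using x a cl step.hyps by (simp add: smult_l_distr M.a_assoc)
    with a y step.hyps show ?thesis by blast
  next
    case False
    have "b \<odot>\<^bsub>M\<^esub> u \<oplus>\<^bsub>M\<^esub> x = a \<odot>\<^bsub>M\<^esub> s \<oplus>\<^bsub>M\<^esub> (b \<odot>\<^bsub>M\<^esub> u \<oplus>\<^bsub>M\<^esub> y)"
      using x a cl step.hyps by (simp add: M.a_lcomm)
    moreover have "b \<odot>\<^bsub>M\<^esub> u \<oplus>\<^bsub>M\<^esub> y \<in> lspan S"
      using False step.hyps y by (intro lspan.step) auto
    ultimately show ?thesis using a by blast
  qed
qed

end

section \<open>Rewriting brackets into Hall trees\<close>

context lie_algebra
begin

lemma bracket_zero_left: "x \<in> carrier M \<Longrightarrow> \<zero>\<^bsub>M\<^esub> \<otimes>\<^bsub>M\<^esub> x = \<zero>\<^bsub>M\<^esub>"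
  using bracket_smult_left[of \<zero> "\<zero>\<^bsub>M\<^esub>" x] by (simp add: bracket_closed)

text \<open>Expand [x + y, x + y] = 0.\<close>

lemma bracket_antisym:
  assumes x: "x \<in> carrier M" and y: "y \<in> carrier M"
  shows "x \<otimes>\<^bsub>M\<^esub> y = \<ominus>\<^bsub>M\<^esub> (y \<otimes>\<^bsub>M\<^esub> x)"
proof -
  have "x \<otimes>\<^bsub>M\<^esub> y \<oplus>\<^bsub>M\<^esub> y \<otimes>\<^bsub>M\<^esub> x = (x \<oplus>\<^bsub>M\<^esub> y) \<otimes>\<^bsub>M\<^esub> (x \<oplus>\<^bsub>M\<^esub> y)"
    using x y bracket_self[OF x] bracket_self[OF y]
    by (simp add: bracket_add_left bracket_add_right bracket_closed M.a_comm)
  also have "\<dots> = \<zero>\<^bsub>M\<^esub>" using x y by (simp add: bracket_self)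
  finally have "x \<otimes>\<^bsub>M\<^esub> y \<oplus>\<^bsub>M\<^esub> y \<otimes>\<^bsub>M\<^esub> x = \<zero>\<^bsub>M\<^esub>" .
  then show ?thesis using x y by (simp add: bracket_closed M.minus_equality)
qed

text \<open>The Jacobi identity, rearranged by antisymmetry, says that bracketing with
  \<open>z\<close> on the right is a derivation.\<close>

lemma bracket_bracket_left:
  assumes x: "x \<in> carrier M" and y: "y \<in> carrier M" and z: "z \<in> carrier M"
  shows "(x \<otimes>\<^bsub>M\<^esub> y) \<otimes>\<^bsub>M\<^esub> z = (x \<otimes>\<^bsub>M\<^esub> z) \<otimes>\<^bsub>M\<^esub> y \<oplus>\<^bsub>M\<^esub> x \<otimes>\<^bsub>M\<^esub> (y \<otimes>\<^bsub>M\<^esub> z)"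
proof -
  have minus_left: "(\<ominus>\<^bsub>M\<^esub> u) \<otimes>\<^bsub>M\<^esub> v = \<ominus>\<^bsub>M\<^esub> (u \<otimes>\<^bsub>M\<^esub> v)"
    if "u \<in> carrier M" "v \<in> carrier M" for u v
    using bracket_smult_left[of "\<ominus> \<one>" u v] that by (simp add: smult_l_minus bracket_closed)
  have "y \<otimes>\<^bsub>M\<^esub> (z \<otimes>\<^bsub>M\<^esub> x) = (x \<otimes>\<^bsub>M\<^esub> z) \<otimes>\<^bsub>M\<^esub> y"
    using bracket_antisym[OF y, of "z \<otimes>\<^bsub>M\<^esub> x"] bracket_antisym[OF x z]
      minus_left[of "z \<otimes>\<^bsub>M\<^esub> x" y] x y z by (simp add: bracket_closed)
  moreover have "z \<otimes>\<^bsub>M\<^esub> (x \<otimes>\<^bsub>M\<^esub> y) = \<ominus>\<^bsub>M\<^esub> ((x \<otimes>\<^bsub>M\<^esub> y) \<otimes>\<^bsub>M\<^esub> z)"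
    using bracket_antisym[of z "x \<otimes>\<^bsub>M\<^esub> y"] x y z by (simp add: bracket_closed)
  ultimately have "((x \<otimes>\<^bsub>M\<^esub> z) \<otimes>\<^bsub>M\<^esub> y \<oplus>\<^bsub>M\<^esub> x \<otimes>\<^bsub>M\<^esub> (y \<otimes>\<^bsub>M\<^esub> z)) \<oplus>\<^bsub>M\<^esub> \<ominus>\<^bsub>M\<^esub> ((x \<otimes>\<^bsub>M\<^esub> y) \<otimes>\<^bsub>M\<^esub> z) = \<zero>\<^bsub>M\<^esub>"
    using jacobi[OF x y z] x y z by (simp add: bracket_closed M.a_ac)
  from M.minus_equality[OF this] show ?thesis using x y z by (simp add: bracket_closed)
qed

lemma lspan_bracket_left:
  assumes "x \<in> lspan S" "S \<subseteq> carrier M" "T \<subseteq> carrier M" "y \<in> carrier M"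
    and "\<And>s. s \<in> S \<Longrightarrow> s \<otimes>\<^bsub>M\<^esub> y \<in> lspan T"
  shows "x \<otimes>\<^bsub>M\<^esub> y \<in> lspan T"
  using assms(1)
proof (induction rule: lspan.induct)
  case zero
  then show ?case using assms(4) by (simp add: bracket_zero_left lspan.zero)
next
  case (step a s x)
  have "(a \<odot>\<^bsub>M\<^esub> s \<oplus>\<^bsub>M\<^esub> x) \<otimes>\<^bsub>M\<^esub> y = a \<odot>\<^bsub>M\<^esub> (s \<otimes>\<^bsub>M\<^esub> y) \<oplus>\<^bsub>M\<^esub> x \<otimes>\<^bsub>M\<^esub> y"
    using step.hyps assms(2,4) lspan_closed[OF step.hyps(3) assms(2)]
    by (simp add: bracket_add_left bracket_smult_left subset_iff)
  then show ?case
    using step assms by (simp add: lspan_add lspan_smult)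
qed

lemma lspan_bracket_right:
  assumes "x \<in> lspan S" "S \<subseteq> carrier M" "T \<subseteq> carrier M" "y \<in> carrier M"
    and "\<And>s. s \<in> S \<Longrightarrow> y \<otimes>\<^bsub>M\<^esub> s \<in> lspan T"
  shows "y \<otimes>\<^bsub>M\<^esub> x \<in> lspan T"
proof -
  have "s \<otimes>\<^bsub>M\<^esub> y \<in> lspan T" if "s \<in> S" for s
    using lspan_minus[OF assms(5)[OF that] assms(3)] bracket_antisym[of s y] that assms(2,4) by auto
  then have "x \<otimes>\<^bsub>M\<^esub> y \<in> lspan T" using assms lspan_bracket_left by blast
  then show ?thesis
    using lspan_minus[OF _ assms(3)] bracket_antisym[of y x] lspan_closed[OF assms(1,2)] assms(4) by simp
qed

lemma lie_eval_hall_closed: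
  "g \<in> \<Lambda> \<rightarrow> carrier M \<Longrightarrow> t \<in> hall r \<Lambda> \<Longrightarrow> lie_eval M g t \<in> carrier M"
  by (rule lie_eval_closed[OF _ hall_lie_exprs])

text \<open>
  Rewriting \<open>[[x, y], t]\<close> as \<open>[[x, t], y] + [x, [y, t]]\<close> when \<open>y < t\<close> expresses it by brackets
  of Hall trees below \<open>t\<close>. This terminates since only finitely many words of bounded length in the
  letters of the given trees lie below the foliage of \<open>t\<close>.
\<close>

lemma bracket_hall_less:
  fixes \<Lambda> :: "'x set"
  assumes "letter_order r" and g: "g \<in> \<Lambda> \<rightarrow> carrier M" and X: "finite X"
    and "s \<in> hall r \<Lambda>" "t \<in> hall r \<Lambda>" "(foliage s, foliage t) \<in> lexord r"
    and "set (foliage s) \<subseteq> X" "set (foliage t) \<subseteq> X"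
    and "length (foliage s) + length (foliage t) = n"
  shows "lie_eval M g s \<otimes>\<^bsub>M\<^esub> lie_eval M g t \<in> lspan (lie_eval M g `
    {h \<in> hall r \<Lambda>. set (foliage h) \<subseteq> X \<and> length (foliage h) = n \<and> (foliage h, foliage t) \<in> lexord r})"
  using assms(4-)
\<comment> \<open>The outer induction on the total length covers [x, t] and [y, t]; the inner one,
  on the number of words below \<open>foliage t\<close>, covers brackets of total length
  \<open>n\<close> whose larger tree lies below \<open>t\<close>.\<close>
proof (induction n arbitrary: s t rule: less_induct)
  case (less n)
  note IH_n = less.IH
  interpret letter_order r by fact
  define H where "H = (\<lambda>n b. {h \<in> hall r \<Lambda>. set (foliage h) \<subseteq> X \<and> length (foliage h) = n \<and> foliage h \<prec> b}
    :: ('a, 'x) lie_expr set)"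
  \<comment> \<open>Its cardinality is the inner measure. All lengths up to \<open>n\<close> are
    allowed because \<open>foliage k\<close> itself, of length at most \<open>n\<close>, must be the
    word that is in \<open>W (foliage t)\<close> but not in \<open>W (foliage k)\<close>.\<close>
  define W where "W = (\<lambda>b. {v. set v \<subseteq> X \<and> length v \<le> n \<and> v \<prec> b})"
  have fin: "finite (W b)" for b
    unfolding W_def by (rule finite_subset[OF _ finite_lists_length_le[OF X, of n]]) auto
  let ?ev = "lie_eval M g"
  have cl: "h \<in> hall r \<Lambda> \<Longrightarrow> ?ev h \<in> carrier M" for h
    by (rule lie_eval_hall_closed[OF g])
  have Hcl: "?ev ` H m b \<subseteq> carrier M" for m b
    using cl by (auto simp: H_def)
  show ?case
    using less.prems
  proof (induction "card (W (foliage t))" arbitrary: s t rule: less_induct)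
    case less
    note s = less.prems(1) and t = less.prems(2) and st = less.prems(3)
      and letters = less.prems(4,5) and len = less.prems(6)
    let ?S = "?ev ` H n (foliage t)"
    \<comment> \<open>Antisymmetry puts the two trees in increasing order, and the inner hypothesis
      applies with the larger one in place of \<open>t\<close>; trees with equal words coincide and
      have bracket zero.\<close>
    have below: "?ev h \<otimes>\<^bsub>M\<^esub> ?ev k \<in> lspan ?S"
      if "h \<in> hall r \<Lambda>" "k \<in> hall r \<Lambda>" "foliage h \<prec> foliage t" "foliage k \<prec> foliage t"
        "set (foliage h) \<subseteq> X" "set (foliage k) \<subseteq> X"
        "length (foliage h) + length (foliage k) = n" for h k
    proof -
      have ordered: "?ev h \<otimes>\<^bsub>M\<^esub> ?ev k \<in> lspan ?S"
        if h: "h \<in> hall r \<Lambda>" and k: "k \<in> hall r \<Lambda>" and hk: "foliage h \<prec> foliage k"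
          and kt: "foliage k \<prec> foliage t"
          and lets: "set (foliage h) \<subseteq> X" "set (foliage k) \<subseteq> X"
          and n: "length (foliage h) + length (foliage k) = n" for h k
      proof -
        have "W (foliage k) \<subset> W (foliage t)"
          using kt lets n less_word_trans less_word_irrefl unfolding W_def by fastforce
        then have "card (W (foliage k)) < card (W (foliage t))"
          by (rule psubset_card_mono[OF fin])
        from less.hyps[OF this h k hk lets n]
        have "?ev h \<otimes>\<^bsub>M\<^esub> ?ev k \<in> lspan (?ev ` H n (foliage k))" by (simp add: H_def)
        then show ?thesis
          by (rule lspan_mono) (use kt less_word_trans in \<open>auto simp: H_def\<close>)
      qed
      consider "foliage h \<prec> foliage k" | "h = k" | "foliage k \<prec> foliage h"
        using less_word_linear foliage_hall_inj \<open>h \<in> hall r \<Lambda>\<close> \<open>k \<in> hall r \<Lambda>\<close> by blast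
      then show ?thesis
      proof cases
        case 1
        then show ?thesis using ordered that by blast
      next
        case 2
        then show ?thesis using that by (simp add: bracket_self cl lspan.zero)
      next
        case 3
        then have "?ev k \<otimes>\<^bsub>M\<^esub> ?ev h \<in> lspan ?S" using ordered that by (simp add: add.commute)
        then show ?thesis
          using lspan_minus[OF _ Hcl] bracket_antisym[OF cl cl] that by metis
      qed
    qed
    show ?case
    proof (cases "Bracket s t \<in> (hall r \<Lambda> :: ('a, 'x) lie_expr set)")
      case True
      \<comment> \<open>Here the bracket is itself one of the spanning trees; only its position
        below \<open>foliage t\<close> has to be checked.\<close>
      have "foliage s @ foliage t \<prec> foliage t"
        using lyndon_append_less hall_lyndon[OF t] foliage_hall_nonempty[OF s] st by blast
      then have "Bracket s t \<in> H n (foliage t)"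
        using True letters len by (simp add: H_def)
      from lspan_base[OF imageI[OF this, of ?ev] Hcl] show ?thesis by (simp add: H_def)
    next
      case False
      \<comment> \<open>The only premise of \<open>hall.Bracket\<close> that can fail is the last
        one.\<close>
      obtain x y where sxy: "s = Bracket x y" and yt: "foliage y \<prec> foliage t"
        using False hall.Bracket[OF s t st] by blast
      have x: "x \<in> hall r \<Lambda>" and y: "y \<in> hall r \<Lambda>" and xy: "foliage x \<prec> foliage y"
        using s sxy by (auto elim: hall_BracketE)
      have xt: "foliage x \<prec> foliage t" using xy yt less_word_trans by blast
      have pos: "length (foliage x) > 0" "length (foliage y) > 0"
        using x y foliage_hall_nonempty by auto
      have lets: "set (foliage x) \<subseteq> X" "set (foliage y) \<subseteq> X" using letters sxy by auto
      \<comment> \<open>By the outer hypothesis [x, t] is a combination of Hall trees below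
        \<open>t\<close>. Since \<open>y\<close> is below \<open>t\<close> as well,
        \<open>below\<close> handles the bracket of each of them with \<open>y\<close>; the term [x,
        [y, t]] is treated likewise.\<close>
      have "?ev x \<otimes>\<^bsub>M\<^esub> ?ev t \<in> lspan (?ev ` H (length (foliage x) + length (foliage t)) (foliage t))"
        unfolding H_def by (rule IH_n) (use x t xt lets letters sxy len pos in auto)
      then have 1: "(?ev x \<otimes>\<^bsub>M\<^esub> ?ev t) \<otimes>\<^bsub>M\<^esub> ?ev y \<in> lspan ?S"
        by (rule lspan_bracket_left[OF _ Hcl Hcl cl[OF y]])
          (use below y yt lets sxy len in \<open>auto simp: H_def\<close>)
      have "?ev y \<otimes>\<^bsub>M\<^esub> ?ev t \<in> lspan (?ev ` H (length (foliage y) + length (foliage t)) (foliage t))"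
        unfolding H_def by (rule IH_n) (use y t yt lets letters sxy len pos in auto)
      then have 2: "?ev x \<otimes>\<^bsub>M\<^esub> (?ev y \<otimes>\<^bsub>M\<^esub> ?ev t) \<in> lspan ?S"
        by (rule lspan_bracket_right[OF _ Hcl Hcl cl[OF x]])
          (use below x xt lets sxy len in \<open>auto simp: H_def\<close>)
      have "?ev s \<otimes>\<^bsub>M\<^esub> ?ev t \<in> lspan ?S"
        using lspan_add[OF 1 2 Hcl] bracket_bracket_left[OF cl[OF x] cl[OF y] cl[OF t]] sxy by simp
      then show ?thesis by (simp add: H_def)
    qed
  qed
qed

lemma bracket_hall:
  assumes ord: "letter_order r" and g: "g \<in> \<Lambda> \<rightarrow> carrier M"
    and s: "s \<in> hall r \<Lambda>" and t: "t \<in> hall r \<Lambda>"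
  shows "lie_eval M g s \<otimes>\<^bsub>M\<^esub> lie_eval M g t \<in> lspan (lie_eval M g ` hall r \<Lambda>)"
proof -
  interpret letter_order r by fact
  note cl = lie_eval_hall_closed[OF g]
  have sub: "lie_eval M g ` hall r \<Lambda> \<subseteq> carrier M" using cl by blast
  \<comment> \<open>The finite alphabet is the set of letters of the two trees, so
    \<open>\<Lambda>\<close> may be infinite.\<close>
  have ordered: "lie_eval M g s \<otimes>\<^bsub>M\<^esub> lie_eval M g t \<in> lspan (lie_eval M g ` hall r \<Lambda>)"
    if "s \<in> hall r \<Lambda>" "t \<in> hall r \<Lambda>" "foliage s \<prec> foliage t" for s t
    by (rule lspan_mono[OF bracket_hall_less[OF ord g _ that,
            of "set (foliage s) \<union> set (foliage t)", OF _ _ _ HOL.refl]]) auto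
  consider "foliage s \<prec> foliage t" | "s = t" | "foliage t \<prec> foliage s"
    using less_word_linear foliage_hall_inj s t by blast
  then show ?thesis
  proof cases
    case 1
    then show ?thesis using ordered s t by blast
  next
    case 2
    then show ?thesis using cl[OF t] by (simp add: bracket_self lspan.zero)
  next
    case 3
    then show ?thesis
      using lspan_minus[OF ordered[OF t s] sub] bracket_antisym[OF cl[OF s] cl[OF t]] by simp
  qed
qed

text \<open>The span is closed under the module operations, and by bilinearity the bracket case
  reduces to \<open>bracket_hall\<close> on pairs of Hall trees.\<close>

lemma lie_eval_in_hall_span:
  assumes ord: "letter_order r" and g: "g \<in> \<Lambda> \<rightarrow> carrier M" and t: "t \<in> lie_exprs R \<Lambda>"
  shows "lie_eval M g t \<in> lspan (lie_eval M g ` (hall r \<Lambda> :: ('a, 'x) lie_expr set))"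
proof -
  let ?S = "lie_eval M g ` (hall r \<Lambda> :: ('a, 'x) lie_expr set)"
  have sub: "?S \<subseteq> carrier M" using lie_eval_hall_closed[OF g] by blast
  show ?thesis
    using t
  proof induction
    case (Gen x)
    then show ?case by (intro lspan_base sub imageI hall.Gen)
  next
    case (Bracket s t)
    note cl = lspan_closed[OF _ sub]
    have "u \<otimes>\<^bsub>M\<^esub> lie_eval M g t \<in> lspan ?S" if "u \<in> ?S" for u
      using Bracket.IH(2) sub sub
      by (rule lspan_bracket_right) (use that sub bracket_hall[OF ord g] in auto)
    with lspan_bracket_left[OF Bracket.IH(1) sub sub cl[OF Bracket.IH(2)]]
    show ?case by simp
  qed (simp_all add: lspan.zero lspan_add[OF _ _ sub] lspan_minus[OF _ sub] lspan_smult[OF _ _ sub])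
qed

end


section \<open>Leading words\<close>

context cring
begin

text \<open>Homogeneity is built in because the order respects concatenation only for words of equal
  length. The coefficient is exactly \<open>\<one>\<close> so that products of leading coefficients
  cannot vanish through zero divisors.\<close>

definition leading_word :: "('x \<times> 'x) set \<Rightarrow> ('x list \<Rightarrow> 'a) \<Rightarrow> 'x list \<Rightarrow> bool" where
  "leading_word r p w \<longleftrightarrow> p w = \<one> \<and>
     (\<forall>v. p v \<noteq> \<zero> \<longrightarrow> length v = length w \<and> (w = v \<or> (w, v) \<in> lexord r))"

lemma leading_wordD:
  assumes "leading_word r p w" "p v \<noteq> \<zero>"
  shows "length v = length w" "w = v \<or> (w, v) \<in> lexord r"
  using assms by (simp_all add: leading_word_def)

text \<open>At \<open>u @ v\<close> only the cut after \<open>length u\<close> contributes, because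
  \<open>p\<close> is homogeneous. At any other word of the product some cut has both factors
  nonzero, and \<open>append_leq_word\<close> compares the pieces.\<close>

lemma leading_word_conv:
  assumes "letter_order r" "range p \<subseteq> carrier R" "range q \<subseteq> carrier R"
    and p: "leading_word r p u" and q: "leading_word r q v"
  shows "leading_word r (conv p q) (u @ v)"
proof -
  interpret letter_order r by fact
  have pcl: "p w \<in> carrier R" and qcl: "q w \<in> carrier R" for w
    using assms by auto
  have nz: "p (take i w) \<noteq> \<zero>" "q (drop i w) \<noteq> \<zero>"
    if "p (take i w) \<otimes> q (drop i w) \<noteq> \<zero>" for i w
    using that pcl qcl by auto
  have "conv p q (u @ v) = (\<Oplus>i\<in>{..length (u @ v)}. if length u = i then \<one> else \<zero>)"
    unfolding conv_def
  proof (rule finsum_cong')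
    fix i assume i: "i \<in> {..length (u @ v)}"
    show "p (take i (u @ v)) \<otimes> q (drop i (u @ v)) = (if length u = i then \<one> else \<zero>)"
    proof (cases "length u = i")
      case True
      then show ?thesis using p q by (auto simp: leading_word_def)
    next
      case False
      then have "p (take i (u @ v)) = \<zero>"
        using p i unfolding leading_word_def by (metis atMost_iff length_take min.absorb2)
      then show ?thesis using False qcl by simp
    qed
  qed auto
  also have "\<dots> = \<one>" by (subst finsum_singleton[of "length u" _ "\<lambda>_. \<one>"]) auto
  finally have "conv p q (u @ v) = \<one>" .
  moreover have "length w = length (u @ v) \<and> u @ v \<preceq> w" if w: "conv p q w \<noteq> \<zero>" for w
  proof -
    obtain i where "p (take i w) \<otimes> q (drop i w) \<noteq> \<zero>"
    proof (rule ccontr)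
      assume "\<not> thesis"
      then have "\<And>i. p (take i w) \<otimes> q (drop i w) = \<zero>" using that by blast
      with w show False by (simp add: conv_def)
    qed
    note nz[OF this]
    then have "length (take i w) = length u" "u \<preceq> take i w" "length (drop i w) = length v" "v \<preceq> drop i w"
      using p q unfolding leading_word_def by blast+
    then show ?thesis
      using append_leq_word[of u "take i w" v "drop i w"]
      by (metis append_take_drop_id length_append)
  qed
  ultimately show ?thesis by (simp add: leading_word_def)
qed

section \<open>Evaluation of Hall trees in noncommutative polynomials\<close>

lemma free_assoc_apply_closed:
  "p \<in> carrier (free_assoc R \<Lambda>) \<Longrightarrow> range p \<subseteq> carrier R"
  by (auto simp: free_assoc_def)

lemma free_assoc_apply:
  "(p \<oplus>\<^bsub>free_assoc R \<Lambda>\<^esub> q) w = p w \<oplus> q w"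
  "(a \<odot>\<^bsub>free_assoc R \<Lambda>\<^esub> p) w = a \<otimes> p w"
  "\<zero>\<^bsub>free_assoc R \<Lambda>\<^esub> w = \<zero>"
  "p \<otimes>\<^bsub>free_assoc R \<Lambda>\<^esub> q = conv p q"
  by (simp_all add: free_assoc_def conv_def fun_eq_iff)

text \<open>Subtraction comes from the abstract additive inverse, so its coefficients are recovered
  from (p - q) + q = p.\<close>

lemma free_assoc_minus_apply:
  assumes p: "p \<in> carrier (free_assoc R \<Lambda>)" and q: "q \<in> carrier (free_assoc R \<Lambda>)"
  shows "(p \<ominus>\<^bsub>free_assoc R \<Lambda>\<^esub> q) w = p w \<ominus> q w"
proof -
  interpret A: assoc_algebra R "free_assoc R \<Lambda>" by (rule assoc_algebra_free_assoc)
  have m: "p \<ominus>\<^bsub>free_assoc R \<Lambda>\<^esub> q \<in> carrier (free_assoc R \<Lambda>)" using p q by simp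
  have "(p \<ominus>\<^bsub>free_assoc R \<Lambda>\<^esub> q) \<oplus>\<^bsub>free_assoc R \<Lambda>\<^esub> q = p"
    using p q by (simp add: a_minus_def A.M.a_assoc A.M.l_neg)
  then have "(p \<ominus>\<^bsub>free_assoc R \<Lambda>\<^esub> q) w \<oplus> q w = p w"
    using free_assoc_apply(1)[of \<Lambda> "p \<ominus>\<^bsub>free_assoc R \<Lambda>\<^esub> q" q w] by simp
  moreover have "(p \<ominus>\<^bsub>free_assoc R \<Lambda>\<^esub> q) w \<in> carrier R" "q w \<in> carrier R"
    using free_assoc_apply_closed[OF m] free_assoc_apply_closed[OF q] by auto
  ultimately show ?thesis
    by (metis a_assoc a_inv_closed a_minus_def r_neg r_zero)
qed

text \<open>In the commutator the second product has leading word
  \<open>foliage t @ foliage s\<close>, strictly above \<open>foliage s @ foliage t\<close>. It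
  therefore contributes \<open>\<zero>\<close> at the latter word and elsewhere only larger
  words.\<close>

lemma leading_word_hall:
  fixes t :: "('a, 'x) lie_expr"
  assumes "letter_order r" "t \<in> hall r \<Lambda>"
  shows "leading_word r (lie_eval (commutator_lie (free_assoc R \<Lambda>)) (free_assoc_gen R) t) (foliage t)"
  using assms(2)
proof (induction rule: hall.induct)
  case (Gen x)
  then show ?case by (auto simp: leading_word_def free_assoc_gen_def split: if_splits)
next
  case (Bracket s t)
  interpret letter_order r by fact
  interpret A: assoc_algebra R "free_assoc R \<Lambda>" by (rule assoc_algebra_free_assoc)
  interpret L: lie_algebra R "commutator_lie (free_assoc R \<Lambda>)" by (rule A.commutator_lie_algebra)
  define p where "p = lie_eval (commutator_lie (free_assoc R \<Lambda>)) (free_assoc_gen R) s"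
  define q where "q = lie_eval (commutator_lie (free_assoc R \<Lambda>)) (free_assoc_gen R) t"
  have gen: "free_assoc_gen R \<in> \<Lambda> \<rightarrow> carrier (commutator_lie (free_assoc R \<Lambda>))"
    by (simp add: free_assoc_gen_closed)
  have pq: "p \<in> carrier (free_assoc R \<Lambda>)" "q \<in> carrier (free_assoc R \<Lambda>)"
    using Bracket.hyps(1,2)[THEN L.lie_eval_hall_closed[OF gen]] by (simp_all add: p_def q_def)
  note rng = pq[THEN free_assoc_apply_closed]
  have lead: "leading_word r (conv p q) (foliage s @ foliage t)"
    "leading_word r (conv q p) (foliage t @ foliage s)"
    using leading_word_conv[OF assms(1)] rng Bracket.IH[folded p_def q_def] by blast+
  have swap: "foliage s @ foliage t \<prec> foliage t @ foliage s"
    using Bracket.hyps hall_lyndon foliage_hall_nonempty lyndon_append_swap by blast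
  have ev: "lie_eval (commutator_lie (free_assoc R \<Lambda>)) (free_assoc_gen R) (Bracket s t) w =
      conv p q w \<ominus> conv q p w" for w
    using free_assoc_minus_apply[OF A.M.m_closed[OF pq] A.M.m_closed[OF pq(2,1)]]
    by (simp add: p_def q_def free_assoc_apply(4))
  have "conv q p (foliage s @ foliage t) = \<zero>"
    using lead(2) swap less_word_trans less_word_irrefl unfolding leading_word_def by metis
  then have one: "conv p q (foliage s @ foliage t) \<ominus> conv q p (foliage s @ foliage t) = \<one>"
    using lead(1) by (simp add: leading_word_def a_minus_def)
  have "length w = length (foliage s @ foliage t) \<and> foliage s @ foliage t \<preceq> w"
    if w: "conv p q w \<ominus> conv q p w \<noteq> \<zero>" for w
  proof -
    consider "conv p q w \<noteq> \<zero>" | "conv q p w \<noteq> \<zero>"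
      using w by (fastforce simp: a_minus_def)
    then show ?thesis
    proof cases
      case 1
      show ?thesis by (rule conjI[OF leading_wordD[OF lead(1) 1]])
    next
      case 2
      note D = leading_wordD[OF lead(2) 2]
      have "foliage s @ foliage t \<prec> w"
        using D(2) swap less_word_trans[OF swap, of w] by metis
      then show ?thesis using D(1) by simp
    qed
  qed
  with one show ?case unfolding leading_word_def ev foliage.simps by blast
qed

end


section \<open>Injectivity\<close>

text \<open>Take a well-order of the whole type and delete its diagonal.\<close>

lemma ex_letter_order: "\<exists>r :: ('x \<times> 'x) set. letter_order r"
proof -
  obtain r :: "('x \<times> 'x) set" where "well_order_on UNIV r"
    using well_order_on by blast
  then have "trans r" "antisym r" "total r"
    by (auto simp: well_order_on_def linear_order_on_def partial_order_on_def preorder_on_def)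
  then have "letter_order (r - Id)"
    by unfold_locales (auto simp: irrefl_def total_on_def trans_diff_Id)
  then show ?thesis ..
qed

text \<open>The identity is a homomorphism fixing the generators, so it agrees with evaluation. This
  turns the spanning result into one about classes of Hall trees.\<close>

lemma lie_eval_free_lie:
  assumes K: "cring K" and t: "t \<in> lie_exprs K \<Lambda>"
  shows "lie_eval (free_lie K \<Lambda>) (free_lie_gen K \<Lambda>) t = lie_class K \<Lambda> t"
proof -
  interpret L: lie_algebra K "free_lie K \<Lambda>" by (rule lie_algebra_free_lie[OF K])
  have "(\<lambda>x. x) \<in> lie_hom K (free_lie K \<Lambda>) (free_lie K \<Lambda>)"
    by (simp add: lie_hom_def)
  from L.lie_hom_lie_class[OF this, of "free_lie_gen K \<Lambda>", OF _ _ t]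
  show ?thesis by (auto simp: free_lie_gen_closed)
qed

text \<open>Induction on the number of trees: the coefficient of the tree with the least word can be
  read off from the image, so it vanishes and that tree drops out.\<close>

lemma lie_hom_zero_on_hall_span:
  fixes F :: "('k, 'x) lie_expr set" and \<Lambda> :: "'x set"
  assumes K: "cring K" and ord: "letter_order r"
    and f: "f \<in> lie_hom K (free_lie K \<Lambda>) (commutator_lie (free_assoc K \<Lambda>))"
    and gen: "\<And>x. x \<in> \<Lambda> \<Longrightarrow> f (free_lie_gen K \<Lambda> x) = free_assoc_gen K x"
    and F: "finite F" "F \<subseteq> hall r \<Lambda>"
    and x: "x \<in> module.lspan K (free_lie K \<Lambda>) (lie_class K \<Lambda> ` F)"
    and fx: "f x = \<zero>\<^bsub>free_assoc K \<Lambda>\<^esub>"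
  shows "x = \<zero>\<^bsub>free_lie K \<Lambda>\<^esub>"
proof -
  interpret K: cring K by fact
  interpret letter_order r by fact
  interpret L: lie_algebra K "free_lie K \<Lambda>" by (rule lie_algebra_free_lie[OF K])
  interpret A: assoc_algebra K "free_assoc K \<Lambda>" by (rule K.assoc_algebra_free_assoc)
  interpret AL: lie_algebra K "commutator_lie (free_assoc K \<Lambda>)" by (rule A.commutator_lie_algebra)
  have cls: "lie_class K \<Lambda> ` G \<subseteq> carrier (free_lie K \<Lambda>)" if "G \<subseteq> hall r \<Lambda>" for G
    using that hall_lie_exprs by (fastforce simp: free_lie_carrier)
  have fcl: "f y w \<in> carrier K" if "y \<in> carrier (free_lie K \<Lambda>)" for y w
    using f that K.free_assoc_apply_closed[of "f y" \<Lambda>] by (auto simp: lie_hom_def)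
  have lin: "f (a \<odot>\<^bsub>free_lie K \<Lambda>\<^esub> y \<oplus>\<^bsub>free_lie K \<Lambda>\<^esub> z) w = a \<otimes>\<^bsub>K\<^esub> f y w \<oplus>\<^bsub>K\<^esub> f z w"
    if "a \<in> carrier K" "y \<in> carrier (free_lie K \<Lambda>)" "z \<in> carrier (free_lie K \<Lambda>)" for a y z w
    using f that by (simp add: lie_hom_def K.free_assoc_apply)
  have zero: "f \<zero>\<^bsub>free_lie K \<Lambda>\<^esub> w = \<zero>\<^bsub>K\<^esub>" for w
  proof -
    have "f (a \<odot>\<^bsub>free_lie K \<Lambda>\<^esub> y) w = a \<otimes>\<^bsub>K\<^esub> f y w"
      if "a \<in> carrier K" "y \<in> carrier (free_lie K \<Lambda>)" for a y
      using f that by (simp add: lie_hom_def K.free_assoc_apply)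
    from this[of "\<zero>\<^bsub>K\<^esub>" "\<zero>\<^bsub>free_lie K \<Lambda>\<^esub>"] fcl[of "\<zero>\<^bsub>free_lie K \<Lambda>\<^esub>" w]
    show ?thesis by simp
  qed
  have lead: "K.leading_word r (f (lie_class K \<Lambda> h)) (foliage h)" if "h \<in> hall r \<Lambda>" for h
  proof -
    have "f (lie_class K \<Lambda> h) = lie_eval (commutator_lie (free_assoc K \<Lambda>)) (free_assoc_gen K) h"
      by (rule AL.lie_hom_lie_class[OF f _ gen hall_lie_exprs[OF that]])
        (simp add: K.free_assoc_gen_closed)
    then show ?thesis using K.leading_word_hall[OF ord that] by simp
  qed
  show ?thesis
    using F x fx
  proof (induction "card F" arbitrary: F x)
    case 0
    then have "x \<in> L.lspan {}" by simp
    then show ?case by cases auto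
  next
    case (Suc n)
    then have "F \<noteq> {}" by auto
    then obtain h where h: "h \<in> F" "\<forall>k\<in>F. foliage h \<preceq> foliage k"
      using finite_has_least_word[OF Suc.prems(1)] by blast
    let ?G = "F - {h}"
    have G: "?G \<subseteq> hall r \<Lambda>" using Suc.prems(2) by blast
    have ins: "lie_class K \<Lambda> ` F = insert (lie_class K \<Lambda> h) (lie_class K \<Lambda> ` ?G)" using h by blast
    obtain a y where a: "a \<in> carrier K" and y: "y \<in> L.lspan (lie_class K \<Lambda> ` ?G)"
      and x: "x = a \<odot>\<^bsub>free_lie K \<Lambda>\<^esub> lie_class K \<Lambda> h \<oplus>\<^bsub>free_lie K \<Lambda>\<^esub> y"
      using L.lspan_insert[of x "lie_class K \<Lambda> h" "lie_class K \<Lambda> ` ?G"] Suc.prems(3) cls[OF Suc.prems(2)]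
      unfolding ins by blast
    have hcl: "lie_class K \<Lambda> h \<in> carrier (free_lie K \<Lambda>)" and ycl: "y \<in> carrier (free_lie K \<Lambda>)"
      using cls[OF Suc.prems(2)] h L.lspan_closed[OF y cls[OF G]] by auto
    \<comment> \<open>Every other tree in \<open>F\<close> has a different word, hence a larger one,
      and its image involves only words at least that large. None of them reaches
      \<open>foliage h\<close>.\<close>
    have "f z (foliage h) = \<zero>\<^bsub>K\<^esub>" if "z \<in> L.lspan (lie_class K \<Lambda> ` ?G)" for z
      using that
    proof (induction rule: L.lspan.induct)
      case (step b s z)
      then obtain k where k: "k \<in> F" "k \<noteq> h" "s = lie_class K \<Lambda> k" by blast
      have "foliage k \<noteq> foliage h" using k h Suc.prems(2) foliage_hall_inj by blast
      then have "\<not> foliage k \<preceq> foliage h"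
        using h(2) k less_word_trans less_word_irrefl by metis
      then have "f s (foliage h) = \<zero>\<^bsub>K\<^esub>"
        using lead[of k] k Suc.prems(2) unfolding K.leading_word_def by blast
      then show ?case
        using step lin[of b s z] cls[OF G] L.lspan_closed[OF step.hyps(3) cls[OF G]] by auto
    qed (rule zero)
    from this[OF y] have "f x (foliage h) = a"
      using lead[of h] h Suc.prems(2) a by (auto simp: x lin[OF a hcl ycl] K.leading_word_def)
    then have "a = \<zero>\<^bsub>K\<^esub>" using Suc.prems(4) by (simp add: K.free_assoc_apply)
    then have "x = y" using x hcl ycl by simp
    moreover have "n = card ?G" using Suc.hyps(2) h Suc.prems(1) by simp
    ultimately show ?case
      using Suc.hyps(1)[of ?G y] Suc.prems G y by auto
  qed
qed

theorem theorem1p5: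
  fixes K :: "('k, 'r) ring_scheme" and \<Lambda> :: "'x set"
  assumes "cring K"
  shows "inj_on (commutator_evaluation K \<Lambda>) (carrier (free_lie K \<Lambda>))"
proof -
  let ?f = "commutator_evaluation K \<Lambda>"
  interpret L: lie_algebra K "free_lie K \<Lambda>" by (rule lie_algebra_free_lie[OF assms])
  interpret A: assoc_algebra K "free_assoc K \<Lambda>" by (rule cring.assoc_algebra_free_assoc[OF assms])
  have f: "?f \<in> lie_hom K (free_lie K \<Lambda>) (commutator_lie (free_assoc K \<Lambda>))"
    and gen: "\<And>x. x \<in> \<Lambda> \<Longrightarrow> ?f (free_lie_gen K \<Lambda> x) = free_assoc_gen K x"
    using commutator_evaluation[OF assms, of \<Lambda>] by auto
  obtain r :: "('x \<times> 'x) set" where ord: "letter_order r" using ex_letter_order by blast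
  \<comment> \<open>Kernel elements are combinations of Hall trees, and each such combination
    involves only finitely many of them.\<close>
  have ker: "x = \<zero>\<^bsub>free_lie K \<Lambda>\<^esub>"
    if x: "x \<in> carrier (free_lie K \<Lambda>)" and fx: "?f x = \<zero>\<^bsub>free_assoc K \<Lambda>\<^esub>" for x
  proof -
    obtain t where t: "t \<in> lie_exprs K \<Lambda>" "x = lie_class K \<Lambda> t"
      using x unfolding free_lie_carrier by blast
    have "lie_eval (free_lie K \<Lambda>) (free_lie_gen K \<Lambda>) ` hall r \<Lambda> = lie_class K \<Lambda> ` hall r \<Lambda>"
      by (intro image_cong HOL.refl lie_eval_free_lie[OF assms] hall_lie_exprs)
    then have "x \<in> L.lspan (lie_class K \<Lambda> ` hall r \<Lambda>)"
      using L.lie_eval_in_hall_span[OF ord, of "free_lie_gen K \<Lambda>" \<Lambda>, OF _ t(1)]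
        free_lie_gen_closed[of _ \<Lambda> K] lie_eval_free_lie[OF assms t(1)] t(2) by simp
    then obtain F where "finite F" "F \<subseteq> hall r \<Lambda>" "x \<in> L.lspan (lie_class K \<Lambda> ` F)"
      using L.lspan_finite[of x "lie_class K \<Lambda>" "hall r \<Lambda>"] by blast
    then show ?thesis using lie_hom_zero_on_hall_span[OF assms ord f gen _ _ _ fx] by simp
  qed
  show ?thesis
  proof (rule inj_onI)
    fix x y assume x: "x \<in> carrier (free_lie K \<Lambda>)" and y: "y \<in> carrier (free_lie K \<Lambda>)"
      and eq: "?f x = ?f y"
    have cl: "?f x \<in> carrier (free_assoc K \<Lambda>)" "?f y \<in> carrier (free_assoc K \<Lambda>)"
      using f x y by (auto simp: lie_hom_def)
    \<comment> \<open>\<open>lie_hom\<close> speaks of sums and scalar multiples but not of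
      negation, so the difference is written as x + (-1) y.\<close>
    have m: "\<ominus>\<^bsub>K\<^esub> \<one>\<^bsub>K\<^esub> \<odot>\<^bsub>free_lie K \<Lambda>\<^esub> y = \<ominus>\<^bsub>free_lie K \<Lambda>\<^esub> y"
      using y by (simp add: L.smult_l_minus)
    have "?f (x \<oplus>\<^bsub>free_lie K \<Lambda>\<^esub> \<ominus>\<^bsub>K\<^esub> \<one>\<^bsub>K\<^esub> \<odot>\<^bsub>free_lie K \<Lambda>\<^esub> y) =
        ?f x \<oplus>\<^bsub>free_assoc K \<Lambda>\<^esub> \<ominus>\<^bsub>K\<^esub> \<one>\<^bsub>K\<^esub> \<odot>\<^bsub>free_assoc K \<Lambda>\<^esub> ?f y"
      using f x y by (simp add: lie_hom_def)
    also have "\<dots> = \<zero>\<^bsub>free_assoc K \<Lambda>\<^esub>"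
      using cl by (simp add: eq A.smult_l_minus A.M.r_neg)
    finally have "x \<oplus>\<^bsub>free_lie K \<Lambda>\<^esub> \<ominus>\<^bsub>free_lie K \<Lambda>\<^esub> y = \<zero>\<^bsub>free_lie K \<Lambda>\<^esub>"
      using ker[of "x \<oplus>\<^bsub>free_lie K \<Lambda>\<^esub> \<ominus>\<^bsub>free_lie K \<Lambda>\<^esub> y"] x y m by simp
    then show "x = y"
      using x y by (metis L.M.add.inv_closed L.M.minus_equality L.M.minus_minus)
  qed
qed

end
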